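(* For any semisimple Leibniz algebra $\mathfrak{L}$ (finite-dimensional over a field $\mathbb{K}$ of characteristic zero), the Leibniz $n$-kernel of $\mathbf{U}_n(\mathfrak{L})$ coincides with $\mathbf{U}_n(\mathfrak{L})$, i.e. $\mathrm{Leib}_n(\mathbf{U}_n(\mathfrak{L}))=\mathbf{U}_n(\mathfrak{L})$.
   Context: A Leibniz algebra is a vector space $\mathfrak{L}$ with a bilinear bracket satisfying $[[x,y],z]=[[x,z],y]+[x,[y,z]]$. Its Leibniz kernel $\mathrm{Leib}(\mathfrak{L})$ is the two-sided ideal spanned by the squares $[x,x]$, $x\in\mathfrak{L}$. Its radical $\mathrm{rad}(\mathfrak{L})$ is the maximal solvable ideal (solvable: $K^{(m)}=0$ for some $m$, where $K^{(0)}=K$, $K^{(j)}=[K^{(j-1)},K^{(j-1)}]$). $\mathfrak{L}$ is semisimple if $\mathrm{rad}(\mathfrak{L})=\mathrm{Leib}(\mathfrak{L})$. Here $n$ denotes the arity of the bracket. A Leibniz $n$-algebra is a vector space $L$ with an $n$-linear bracket satisfying $[[x_1,\ldots,x_n],y_1,\ldots,y_{n-1}]=\sum_{i=1}^{n}[x_1,\ldots,x_{i-1},[x_i,y_1,\ldots,y_{n-1}],x_{i+1},\ldots,x_n]$; for $n=2$ this is the definition of a Leibniz algebra. For a Leibniz algebra $\mathfrak{L}$, $\mathbf{U}_n(\mathfrak{L})$ is the Leibniz $n$-algebra on the same vector space with bracket $[x_1,\dots,x_n]=[x_1,[\dots,[x_{n-2},[x_{n-1},x_n]]\dots]]$. An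 ideal of a Leibniz $n$-algebra $L$ is a subspace $I$ such that for every $1\le s\le n$ one has $[L,\dots,L,I,L,\dots,L]\subseteq I$ with $I$ in position $s$. The Leibniz $n$-kernel $\mathrm{Leib}_n(L)$ is the ideal of $L$ generated by all brackets $[x_1,\dots,x_n]$ with $x_1,\dots,x_n\in L$ and $x_i=x_j$ for some $i\ne j$.
   Formalization: The arity is assumed to be n ≥ 3; for n = 2 the claim fails, e.g. for sl_2, where U_2(L) = L and Leib_2(U_2(L)) = Leib(L) = 0. *)

theory Defs
  imports Complex_Main "HOL.Hull"
begin

locale leibniz_algebra = vector_space scale
  for scale :: "'k::field \<Rightarrow> 'v::ab_group_add \<Rightarrow> 'v" (infixr "*s" 75) +
  fixes bracket :: "'v \<Rightarrow> 'v \<Rightarrow> 'v" ("\<lbrakk>_,/ _\<rbrakk>")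
  assumes linear_bracket_left: "\<And>y. Vector_Spaces.linear (*s) (*s) (\<lambda>x. \<lbrakk>x, y\<rbrakk>)"
    and linear_bracket_right: "\<And>x. Vector_Spaces.linear (*s) (*s) (\<lambda>y. \<lbrakk>x, y\<rbrakk>)"
    and leibniz_identity: "\<And>x y z. \<lbrakk>\<lbrakk>x, y\<rbrakk>, z\<rbrakk> = \<lbrakk>\<lbrakk>x, z\<rbrakk>, y\<rbrakk> + \<lbrakk>x, \<lbrakk>y, z\<rbrakk>\<rbrakk>"
begin

definition ideal :: "'v set \<Rightarrow> bool" where
  "ideal I \<longleftrightarrow> subspace I \<and> (\<forall>x\<in>I. \<forall>y. \<lbrakk>x, y\<rbrakk> \<in> I \<and> \<lbrakk>y, x\<rbrakk> \<in> I)"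

text \<open>The span of the squares is automatically a two-sided ideal, see \<open>ideal_leib_kernel\<close>.\<close>

definition leib_kernel :: "'v set" where
  "leib_kernel = span {\<lbrakk>x, x\<rbrakk> | x. True}"

definition bracket_sets :: "'v set \<Rightarrow> 'v set \<Rightarrow> 'v set" where
  "bracket_sets A B = span {\<lbrakk>x, y\<rbrakk> | x y. x \<in> A \<and> y \<in> B}"

primrec derived_series :: "'v set \<Rightarrow> nat \<Rightarrow> 'v set" where
  "derived_series K 0 = K"
| "derived_series K (Suc j) = bracket_sets (derived_series K j) (derived_series K j)"

definition solvable :: "'v set \<Rightarrow> bool" where
  "solvable K \<longleftrightarrow> (\<exists>m. derived_series K m = {0})"

text \<open>The greatest solvable ideal with respect to inclusion; it exists in finite dimension,
  see \<open>radical_is_greatest\<close>.\<close>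

definition radical :: "'v set" where
  "radical = (GREATEST I. ideal I \<and> solvable I)"

definition semisimple :: bool where
  "semisimple \<longleftrightarrow> radical = leib_kernel"

end

text \<open>An \<open>n\<close>-ary bracket is a function on lists, only its values on lists of length \<open>n\<close> being
  relevant; positions are counted from \<open>0\<close>.\<close>

locale leibniz_n_algebra = vector_space scale
  for scale :: "'k::field \<Rightarrow> 'v::ab_group_add \<Rightarrow> 'v" (infixr "*s" 75) +
  fixes n :: nat and nbracket :: "'v list \<Rightarrow> 'v"
  assumes arity: "n \<ge> 2"
    and multilinear: "\<And>xs i. length xs = n \<Longrightarrow> i < n \<Longrightarrow>
      Vector_Spaces.linear (*s) (*s) (\<lambda>x. nbracket (xs[i := x]))"
    and leibniz_n_identity: "\<And>xs ys. length xs = n \<Longrightarrow> length ys = n - 1 \<Longrightarrow>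
      nbracket (nbracket xs # ys) = (\<Sum>i<n. nbracket (xs[i := nbracket (xs ! i # ys)]))"
begin

definition n_ideal :: "'v set \<Rightarrow> bool" where
  "n_ideal I \<longleftrightarrow> subspace I \<and>
     (\<forall>s<n. \<forall>xs. length xs = n \<and> xs ! s \<in> I \<longrightarrow> nbracket xs \<in> I)"

definition leib_n_kernel :: "'v set" where
  "leib_n_kernel = n_ideal hull
     {nbracket xs | xs. length xs = n \<and> (\<exists>i<n. \<exists>j<n. i \<noteq> j \<and> xs ! i = xs ! j)}"

end

text \<open>The bracket of \<open>\<^bold>U\<^sub>n(L)\<close> for all \<open>n\<close> at once, the arity being the length of the list.
  The value on the empty list is a dummy.\<close>

fun U_bracket :: "('v \<Rightarrow> 'v \<Rightarrow> 'v) \<Rightarrow> 'v list \<Rightarrow> 'v::zero" where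
  "U_bracket br [] = 0"
| "U_bracket br [x] = x"
| "U_bracket br (x # y # xs) = br x (U_bracket br (y # xs))"

context leibniz_algebra
begin

lemma bracket_simps:
  "\<lbrakk>x + x', y\<rbrakk> = \<lbrakk>x, y\<rbrakk> + \<lbrakk>x', y\<rbrakk>" "\<lbrakk>x, y + y'\<rbrakk> = \<lbrakk>x, y\<rbrakk> + \<lbrakk>x, y'\<rbrakk>"
  "\<lbrakk>c *s x, y\<rbrakk> = c *s \<lbrakk>x, y\<rbrakk>" "\<lbrakk>x, c *s y\<rbrakk> = c *s \<lbrakk>x, y\<rbrakk>"
  "\<lbrakk>0, y\<rbrakk> = 0" "\<lbrakk>x, 0\<rbrakk> = 0"
  using linear_bracket_left[of y] linear_bracket_right[of x]
  by (simp_all add: linear_iff module_hom_iff Vector_Spaces.linear_def)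
     (metis linear_bracket_left linear_bracket_right Vector_Spaces.linear.axioms(3) module_hom.zero)+

lemma bracket_sum_right: "\<lbrakk>x, (\<Sum>i\<in>A. f i)\<rbrakk> = (\<Sum>i\<in>A. \<lbrakk>x, f i\<rbrakk>)"
  by (induction A rule: infinite_finite_induct) (simp_all add: bracket_simps)

lemma ideal_leib_kernel: "ideal leib_kernel"
proof -
  have right: "\<lbrakk>x, y\<rbrakk> \<in> leib_kernel" if "x \<in> leib_kernel" for x y
    using that unfolding leib_kernel_def
  proof (induction rule: span_induct)
    case base
    show ?case
      by (auto simp: subspace_def bracket_simps span_zero span_add span_scale)
  next
    case (step x)
    then obtain z where x: "x = \<lbrakk>z, z\<rbrakk>" by auto
    have sq: "\<lbrakk>w, w\<rbrakk> \<in> span {\<lbrakk>x, x\<rbrakk> | x. True}" for w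
      by (rule span_base) auto
    have "\<lbrakk>x, y\<rbrakk> = \<lbrakk>\<lbrakk>z, y\<rbrakk> + z, \<lbrakk>z, y\<rbrakk> + z\<rbrakk> - \<lbrakk>\<lbrakk>z, y\<rbrakk>, \<lbrakk>z, y\<rbrakk>\<rbrakk> - \<lbrakk>z, z\<rbrakk>"
      unfolding x leibniz_identity[of z z y] by (simp add: bracket_simps)
    then show ?case by (simp only: span_diff sq)
  qed
  have left: "\<lbrakk>y, x\<rbrakk> = 0" if "x \<in> leib_kernel" for x y
    using that unfolding leib_kernel_def
  proof (induction rule: span_induct)
    case base
    show ?case by (auto simp: subspace_def bracket_simps)
  next
    case (step x)
    then obtain z where x: "x = \<lbrakk>z, z\<rbrakk>" by auto
    show ?case unfolding x using leibniz_identity[of y z z] by (simp only: add_cancel_right_right)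
  qed
  show ?thesis
    using right left by (auto simp: ideal_def leib_kernel_def span_zero)
qed

lemma U_bracket_linear:
  "i < length xs \<Longrightarrow> Vector_Spaces.linear (*s) (*s) (\<lambda>x. U_bracket bracket (xs[i := x]))"
proof (induction xs arbitrary: i rule: induct_list012)
  case (3 x y xs)
  show ?case
  proof (cases i)
    case 0
    then show ?thesis by (simp add: linear_bracket_left)
  next
    case (Suc j)
    then have "Vector_Spaces.linear (*s) (*s) (\<lambda>z. U_bracket bracket ((y # xs)[j := z]))"
      using 3 by simp
    moreover have "U_bracket bracket ((x # y # xs)[i := z]) = \<lbrakk>x, U_bracket bracket ((y # xs)[j := z])\<rbrakk>"
      for z using Suc by (cases j) simp_all
    ultimately show ?thesis
      using Vector_Spaces.linear_compose[OF _ linear_bracket_right[of x]] by (simp add: o_def)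
  qed
qed (auto simp: linear_ident)

lemma U_bracket_derivation:
  "xs \<noteq> [] \<Longrightarrow> \<lbrakk>U_bracket bracket xs, z\<rbrakk> = (\<Sum>i<length xs. U_bracket bracket (xs[i := \<lbrakk>xs ! i, z\<rbrakk>]))"
proof (induction xs rule: induct_list012)
  case (3 x y xs)
  have "U_bracket bracket ((x # y # xs)[Suc j := w]) = \<lbrakk>x, U_bracket bracket ((y # xs)[j := w])\<rbrakk>"
    for j w by (cases j) simp_all
  with 3 show ?case
    by (simp only: length_Cons[of x] sum.lessThan_Suc_shift U_bracket.simps list_update_code
        nth_Cons_0 nth_Cons_Suc leibniz_identity[of x _ z] bracket_sum_right list.distinct simp_thms)
qed simp_all

lemma leibniz_n_algebra_U:
  assumes "n \<ge> 2"
  shows "leibniz_n_algebra (*s) n (U_bracket bracket)"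
proof (intro leibniz_n_algebra.intro leibniz_n_algebra_axioms.intro vector_space_axioms)
  fix xs ys :: "'v list"
  assume len: "length xs = n" "length ys = n - 1"
  then have "ys \<noteq> []" "xs \<noteq> []" using assms by auto
  then have "U_bracket bracket (w # ys) = \<lbrakk>w, U_bracket bracket ys\<rbrakk>" for w
    by (cases ys) auto
  with U_bracket_derivation[OF \<open>xs \<noteq> []\<close>] len
  show "U_bracket bracket (U_bracket bracket xs # ys) =
      (\<Sum>i<n. U_bracket bracket (xs[i := U_bracket bracket (xs ! i # ys)]))" by simp
qed (use assms U_bracket_linear in auto)

lemma derived_series_subset: "K \<subseteq> L \<Longrightarrow> derived_series K m \<subseteq> derived_series L m"
proof (induction m)
  case (Suc m)
  then show ?case unfolding derived_series.simps bracket_sets_def by (intro span_mono) blast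
qed simp

lemma derived_series_add: "derived_series K (m + k) = derived_series (derived_series K m) k"
  by (induction k) simp_all

lemma subspace_derived_series: "subspace K \<Longrightarrow> subspace (derived_series K m)"
  by (cases m) (simp_all add: bracket_sets_def)

lemma solvable_sum:
  assumes I: "ideal I" "solvable I" and J: "ideal J" "solvable J"
  shows "ideal {x + y | x y. x \<in> I \<and> y \<in> J}" "solvable {x + y | x y. x \<in> I \<and> y \<in> J}"
proof -
  let ?S = "\<lambda>J. {x + y | x y. x \<in> I \<and> y \<in> J}"
  have sI: "subspace I" and sJ: "subspace J" using assms by (auto simp: ideal_def)
  show "ideal (?S J)"
    unfolding ideal_def
  proof (intro conjI ballI allI)
    show "subspace (?S J)" by (rule subspace_sums[OF sI sJ])
    fix z w assume "z \<in> ?S J"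
    then obtain x y where z: "z = x + y" "x \<in> I" "y \<in> J" by blast
    then have "\<lbrakk>x, w\<rbrakk> \<in> I" "\<lbrakk>w, x\<rbrakk> \<in> I" "\<lbrakk>y, w\<rbrakk> \<in> J" "\<lbrakk>w, y\<rbrakk> \<in> J"
      using I(1) J(1) by (auto simp: ideal_def)
    then show "\<lbrakk>z, w\<rbrakk> \<in> ?S J" "\<lbrakk>w, z\<rbrakk> \<in> ?S J"
      unfolding z(1) bracket_simps by blast+
  qed
  obtain k m where k: "derived_series I k = {0}" and m: "derived_series J m = {0}"
    using assms by (auto simp: solvable_def)
  have sub: "derived_series (?S J) j \<subseteq> ?S (derived_series J j)" for j
  proof (induction j)
    case (Suc j)
    have "\<lbrakk>a, b\<rbrakk> \<in> ?S (derived_series J (Suc j))"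
      if "a \<in> derived_series (?S J) j" "b \<in> derived_series (?S J) j" for a b
    proof -
      from that Suc obtain x y x' y' where e: "a = x + y" "b = x' + y'" "x \<in> I" "x' \<in> I"
        "y \<in> derived_series J j" "y' \<in> derived_series J j" by blast
      have "\<lbrakk>a, b\<rbrakk> = (\<lbrakk>x, x'\<rbrakk> + \<lbrakk>x, y'\<rbrakk> + \<lbrakk>y, x'\<rbrakk>) + \<lbrakk>y, y'\<rbrakk>" by (simp add: e bracket_simps)
      moreover have "\<lbrakk>x, x'\<rbrakk> + \<lbrakk>x, y'\<rbrakk> + \<lbrakk>y, x'\<rbrakk> \<in> I"
        using e I(1) by (auto simp: ideal_def intro!: subspace_add)
      moreover have "\<lbrakk>y, y'\<rbrakk> \<in> derived_series J (Suc j)"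
        using e by (auto simp: bracket_sets_def intro!: span_base)
      ultimately show ?thesis by blast
    qed
    then show ?case
      unfolding derived_series.simps(2)[of "?S J"] bracket_sets_def[of "derived_series (?S J) j"]
      by (intro span_minimal subspace_sums[OF sI] subspace_derived_series sJ) blast
  qed simp
  have "derived_series (?S J) m \<subseteq> I" using sub[of m] m by auto
  then have "derived_series (?S J) (m + k) \<subseteq> {0}"
    unfolding derived_series_add k[symmetric] by (rule derived_series_subset)
  moreover have "0 \<in> derived_series (?S J) (m + k)"
    by (intro subspace_0 subspace_derived_series subspace_sums sI sJ)
  ultimately show "solvable (?S J)" unfolding solvable_def by blast
qed

lemma radical_is_greatest:
  assumes "finite B" "span B = UNIV"
  shows "ideal radical \<and> solvable radical" "\<And>J. ideal J \<Longrightarrow> solvable J \<Longrightarrow> J \<subseteq> radical"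
proof -
  let ?P = "\<lambda>I. ideal I \<and> solvable I"
  have bound: "dim I \<le> card B" for I
    using dim_le_card[of I B] assms by simp
  have P0: "?P {0}"
    by (auto simp: ideal_def bracket_simps solvable_def intro!: exI[of _ 0])
  obtain R where R: "?P R" and max: "\<And>I. ?P I \<Longrightarrow> dim I \<le> dim R"
    using ex_has_greatest_nat[of ?P "{0}" dim "Suc (card B)", OF P0] le_imp_less_Suc[OF bound] by auto
  have great: "J \<subseteq> R" if J: "?P J" for J
  proof -
    let ?S = "{x + y | x y. x \<in> R \<and> y \<in> J}"
    have sR: "subspace R" and sJ: "subspace J" using R J by (auto simp: ideal_def)
    have "?P ?S" using solvable_sum R J by blast
    then have d: "dim ?S \<le> dim R" by (rule max)
    have RS: "R \<subseteq> ?S" "J \<subseteq> ?S" using subspace_0[OF sR] subspace_0[OF sJ]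
      by (force, force)
    obtain C where C: "C \<subseteq> R" "independent C" "R \<subseteq> span C" "card C = dim R"
      using basis_exists[of R] by blast
    have "finite C" using C(2) assms independent_span_bound[of B C] by simp
    have "?S \<subseteq> span C"
    proof
      fix x assume x: "x \<in> ?S"
      show "x \<in> span C"
      proof (rule ccontr)
        assume nx: "x \<notin> span C"
        then have "independent (insert x C)" using C(2) by (simp add: independent_insert)
        moreover have "insert x C \<subseteq> ?S" using x C(1) RS by auto
        ultimately have "card (insert x C) \<le> dim ?S"
        proof -
          interpret finite_dimensional_vector_space "(*s)" "extend_basis {}"
            using assms independent_span_bound[of B "extend_basis {}"]
            by unfold_locales (auto simp: independent_extend_basis span_extend_basis independent_empty)
          show ?thesis using \<open>independent (insert x C)\<close> \<open>insert x C \<subseteq> ?S\<close>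
            by (simp add: independent_card_le_dim)
        qed
        moreover have "x \<notin> C" using nx span_base by blast
        ultimately show False using d C(4) \<open>finite C\<close> by simp
      qed
    qed
    also have "span C \<subseteq> R" using C(1) sR by (rule span_minimal)
    finally show ?thesis using RS by blast
  qed
  have "radical = R"
    unfolding radical_def by (rule Greatest_equality) (use R great in auto)
  with R great show "ideal radical \<and> solvable radical"
    "\<And>J. ideal J \<Longrightarrow> solvable J \<Longrightarrow> J \<subseteq> radical" by auto
qed

end

end

theory Submission
  imports Defs
    "Jordan_Normal_Form.Jordan_Normal_Form_Existence"
    "Jordan_Normal_Form.DL_Rank"
    "HOL-Algebra.Algebraic_Closure_Type"
begin

text \<open>
  The theorem splits into two facts: a semisimple Leibniz algebra is perfect, and over a field with
  \<open>3 \<noteq> 0\<close> the Leibniz \<open>n\<close>-kernel of \<open>\<^bold>U\<^sub>n(L)\<close> with \<open>n \<ge> 3\<close> is everything when \<open>L\<close> is perfect.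

  \<^emph>\<open>Perfect implies the claim.\<close> Let \<open>K\<close> be the Leibniz \<open>n\<close>-kernel. As \<open>L\<close> is perfect, brackets
  of any length span \<open>L\<close>, so the inner part of an \<open>n\<close>-fold bracket may be an arbitrary element:
  \<open>K\<close> contains all \<open>[x,[x,u]]\<close> and satisfies \<open>[K,L] \<subseteq> K\<close>. Hence \<open>T(x,y,z) = [x,[y,z]]\<close>
  alternates modulo \<open>K\<close>, and the Leibniz identity, read as the Jacobi identity modulo the Leibniz
  kernel \<open>I\<close>, turns into \<open>3 T \<in> K + I\<close>. Moreover \<open>[I,L] \<subseteq> K\<close>, because \<open>T(i,y,z)\<close> equals
  \<open>- T(y,i,z)\<close> modulo \<open>K\<close> and \<open>[i,z] \<in> I\<close> is annihilated from the left. So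
  \<open>[T,L] \<subseteq> K\<close>, and perfectness gives \<open>L = [L,L] = [[L,[L,L]],L] \<subseteq> K\<close>; this is
  \<open>perfect_absorbing_subspace_eq_UNIV\<close>.

  \<^emph>\<open>Semisimple implies perfect.\<close> The argument is the classical one with the Killing form
  \<open>\<kappa>(x,y) = tr(R\<^sub>y R\<^sub>x)\<close> of the right multiplications \<open>R\<^sub>x z = [z,x]\<close>. Its radical is a
  solvable ideal (\<open>solvable_killing_radical\<close>), hence equals \<open>I\<close> when \<open>L\<close> is semisimple. If
  \<open>[L,L] \<noteq> L\<close>, a nonzero functional vanishing on \<open>[L,L]\<close> has the form \<open>\<kappa>(y,\<cdot>)\<close>, and
  invariance of \<open>\<kappa>\<close> puts \<open>y\<close> into a solvable ideal, a contradiction (\<open>semisimple_perfect\<close>).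

  Solvability of the radical is Cartan's criterion. Right multiplications are derivations, and for
  a derivation \<open>\<delta>\<close> one has \<open>tr(R\<^bsub>[a,b]\<^esub> \<delta>) = \<kappa>(\<delta> b, a)\<close>; so for \<open>x\<close> in the derived algebra of the
  radical the operator \<open>R\<^sub>x\<close> is trace-orthogonal to \<^emph>\<open>all\<close> derivations of \<open>L\<close>. Such a derivation
  \<open>D\<close> is nilpotent (\<open>derivation_nilpotent\<close>): over the algebraic closure its generalized
  eigenspaces grade the algebra, so for any additive map \<open>\<phi>\<close> from the closure to the rationals the
  operator that acts as \<open>\<phi>(a)\<close> on the eigenspace of \<open>a\<close> is again a derivation; orthogonality reads
  \<open>\<Sum> a \<phi>(a) = 0\<close>, and applying \<open>\<phi>\<close> gives a vanishing sum of rational squares. Engel's theorem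
  (\<open>engel\<close>) then yields solvability.
\<close>

(* The module-theoretic span of the matrix development shadows the one on which vector spaces rest. *)
hide_const LinearCombinations.module.span

section \<open>Jordan bases over an algebraically closed field\<close>

lemma invertible_mat_with_first_column:
  fixes v :: "'a::field vec"
  assumes v: "v \<in> carrier_vec n" and v0: "v \<noteq> 0\<^sub>v n"
  obtains W W' where "W \<in> carrier_mat n n" "W' \<in> carrier_mat n n" "W' * W = 1\<^sub>m n" "W * W' = 1\<^sub>m n" "col W 0 = v"
proof -
  interpret vec_space "TYPE('a)" n .
  note b = basis_completion[OF v v0]
  define W where "W = mat_of_cols n (basis_completion v)"
  have W: "W \<in> carrier_mat n n" 
    unfolding W_def using mat_of_cols_carrier(1)[of n "basis_completion v"] b(6) by simp
  have cols: "cols W = basis_completion v"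
    unfolding W_def by (rule cols_mat_of_cols[OF b(2)])
  have "rank W = n"
    by (rule lin_indpt_full_rank[OF W]) (unfold cols, fact b(4), fact b(5))
  then have "det W \<noteq> 0" using det_rank_iff[OF W] by simp
  then have "W \<in> Units (ring_mat TYPE('a) n undefined)" by (rule det_non_zero_imp_unit[OF W])
  then have "\<exists>W'\<in>carrier_mat n n. W' * W = 1\<^sub>m n \<and> W * W' = 1\<^sub>m n"
    unfolding Units_def ring_mat_simps by blast
  then obtain W' where W': "W' \<in> carrier_mat n n" "W' * W = 1\<^sub>m n" "W * W' = 1\<^sub>m n" by blast
  have "n > 0" using v v0 by (cases n) auto
  then have "basis_completion v ! 0 = v" using b(6,7) by (metis hd_conv_nth length_0_conv less_irrefl)
  then have "col W 0 = v"
    unfolding W_def using b(6) v \<open>n > 0\<close> by (metis col_mat_of_cols)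
  then show ?thesis by (rule that[OF W W'])
qed

text \<open>Induction on the size: an eigenvector, completed to a basis, makes the first column of the
  matrix a multiple of the first unit vector, and the induction hypothesis handles the remaining
  diagonal block.\<close>

lemma triangularizable:
  fixes A :: "'a::alg_closed_field mat"
  assumes "A \<in> carrier_mat n n"
  shows "\<exists>B \<in> carrier_mat n n. upper_triangular B \<and> similar_mat A B"
  using assms
proof (induction n arbitrary: A)
  case 0
  then have "upper_triangular A" "similar_mat A A" by (auto intro: similar_mat_refl[of _ 0])
  with 0 show ?case by blast
next
  case (Suc m A)
  let ?n = "Suc m"
  note A = Suc.prems
  have "Polynomial.degree (char_poly A) > 0" using degree_monic_char_poly[OF A] by simp
  then obtain e where e: "poly (char_poly A) e = 0" using alg_closed_imp_poly_has_root by blast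
  then obtain v where "eigenvector A v e"
    using eigenvalue_root_char_poly[OF A] unfolding eigenvalue_def by blast
  then have v: "v \<in> carrier_vec ?n" "v \<noteq> 0\<^sub>v ?n" "A *\<^sub>v v = e \<cdot>\<^sub>v v"
    using A unfolding eigenvector_def by auto
  obtain W W' where W: "W \<in> carrier_mat ?n ?n" "W' \<in> carrier_mat ?n ?n" "W' * W = 1\<^sub>m ?n"
    "W * W' = 1\<^sub>m ?n" "col W 0 = v"
    using invertible_mat_with_first_column[OF v(1,2)] by blast
  define A' where "A' = W' * A * W"
  have A': "A' \<in> carrier_mat ?n ?n" using W A by (auto simp: A'_def)
  have simA': "similar_mat A A'"
    by (rule similar_mat_sym, unfold similar_mat_def, intro exI)
       (rule similar_mat_witI[of W' W ?n A' A], insert W A, auto simp: A'_def)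
  have "col A' 0 = (W' * A) *\<^sub>v col W 0"
    unfolding A'_def by (rule col_mult2[of _ ?n ?n _ ?n]) (use W A in auto)
  also have "\<dots> = W' *\<^sub>v (A *\<^sub>v v)"
    unfolding W(5) by (rule assoc_mult_mat_vec[OF W(2) A v(1)])
  also have "\<dots> = e \<cdot>\<^sub>v (W' *\<^sub>v col W 0)"
    unfolding v(3) W(5) by (rule mult_mat_vec[OF W(2) v(1)])
  also have "W' *\<^sub>v col W 0 = col (W' * W) 0"
    by (rule col_mult2[symmetric, of _ ?n ?n _ ?n]) (use W(1,2) in auto)
  finally have col0: "col A' 0 = e \<cdot>\<^sub>v unit_vec ?n 0" using W by (simp add: col_one)
  obtain A1 A2 A0 A3 where split: "split_block A' 1 1 = (A1,A2,A0,A3)"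
    by (cases "split_block A' 1 1") auto
  have dims: "A2 \<in> carrier_mat 1 m" "A3 \<in> carrier_mat m m" "A1 \<in> carrier_mat 1 1" "A0 \<in> carrier_mat m 1"
    and block: "A' = four_block_mat A1 A2 A0 A3"
    using split_block[OF split, of m m] A' by auto
  have A0: "A0 = 0\<^sub>m m 1"
  proof (rule eq_matI)
    fix i j assume "i < dim_row (0\<^sub>m m 1)" "j < dim_col (0\<^sub>m m 1)"
    then have ij: "i < m" "j = 0" by auto
    have "A0 $$ (i, j) = A' $$ (Suc i, 0)"
      unfolding block using ij dims by (subst index_mat_four_block) auto
    also have "\<dots> = col A' 0 $ Suc i" using A' ij by simp
    also have "\<dots> = 0" unfolding col0 using ij by simp
    finally show "A0 $$ (i, j) = 0\<^sub>m m 1 $$ (i, j)" using ij by simp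
  qed (use dims in auto)
  obtain B where B: "B \<in> carrier_mat m m" "upper_triangular B" "similar_mat A3 B"
    using Suc.IH[OF dims(2)] by blast
  obtain P Q where sim: "similar_mat_wit A3 B P Q" using B(3) unfolding similar_mat_def by blast
  note PQ = similar_mat_witD2[OF dims(2) sim]
  define C where "C = four_block_mat A1 (A2 * P) A0 B"
  have "A2 = A2 * (P * Q)" using PQ(1) dims(1) by simp
  also have "\<dots> = A2 * P * Q" by (rule assoc_mult_mat[symmetric, OF dims(1) PQ(6,7)])
  finally have 2: "A2 = 1\<^sub>m 1 * (A2 * P) * Q" using dims(1) PQ(6) by simp
  have 0: "A0 = P * A0 * 1\<^sub>m 1" unfolding A0 using PQ(6) by simp
  have "similar_mat A' C"
    unfolding similar_mat_def block C_def
    using similar_mat_wit_four_block[OF similar_mat_wit_refl[OF dims(3)] sim 2 0 dims(3,2,4) mult_carrier_mat[OF dims(1) PQ(6)]]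
    by blast
  then have "similar_mat A C" using simA' similar_mat_trans by blast
  moreover have "upper_triangular C"
    unfolding C_def A0 by (rule upper_triangular_four_block[OF dims(3) B(1) _ B(2)]) (use dims in auto)
  moreover have "C \<in> carrier_mat ?n ?n" unfolding C_def using dims B by auto
  ultimately show ?case by blast
qed

text \<open>This is all that the grading argument below uses of a Jordan matrix: a nonzero entry
  lies on or above the diagonal and joins equal eigenvalues.\<close>

lemma jordan_matrix_entry_nonzero:
  assumes "i < sum_list (map fst n_as)" "j < sum_list (map fst n_as)" "jordan_matrix n_as $$ (i, j) \<noteq> 0"
  shows "i \<le> j \<and> jordan_matrix n_as $$ (i, i) = jordan_matrix n_as $$ (j, j)"
  using assms
proof (induction n_as arbitrary: i j)
  case (Cons p n_as)
  obtain n a where p: "p = (n, a)" by (cases p)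
  consider "i < n" "j < n" | "n \<le> i" "n \<le> j" | "i < n \<longleftrightarrow> \<not> j < n" by linarith
  then show ?case
  proof cases
    case 1
    then show ?thesis using Cons.prems unfolding p jordan_matrix_Cons
      by (auto simp: jordan_block_def split: if_splits)
  next
    case 2
    then have "i - n < sum_list (map fst n_as)" "j - n < sum_list (map fst n_as)"
      "jordan_matrix n_as $$ (i - n, j - n) \<noteq> 0"
      using Cons.prems unfolding p jordan_matrix_Cons by auto
    with 2 show ?thesis using Cons.prems Cons.IH[of "i - n" "j - n"] unfolding p jordan_matrix_Cons
      by auto
  next
    case 3
    then show ?thesis using Cons.prems unfolding p jordan_matrix_Cons by auto
  qed
qed simp

lemma index_mult_mat_sum:
  assumes "A \<in> carrier_mat n m" "B \<in> carrier_mat m l" "i < n" "j < l"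
  shows "(A * B) $$ (i, j) = (\<Sum>k<m. A $$ (i, k) * B $$ (k, j))"
  using assms by (simp add: scalar_prod_def atLeast0LessThan)

text \<open>The Jordan form in terms of functions on indices: the columns of \<open>P\<close> are the basis vectors, the
  rows of \<open>Q\<close> the dual basis.\<close>

lemma jordan_basis:
  fixes D :: "nat \<Rightarrow> nat \<Rightarrow> 'a::alg_closed_field"
  obtains P Q J :: "nat \<Rightarrow> nat \<Rightarrow> 'a" where
    "\<And>i j. i < d \<Longrightarrow> j < d \<Longrightarrow> (\<Sum>a<d. Q i a * P a j) = (if i = j then 1 else 0)"
    "\<And>i j. i < d \<Longrightarrow> j < d \<Longrightarrow> (\<Sum>a<d. P i a * Q a j) = (if i = j then 1 else 0)"
    "\<And>i j. i < d \<Longrightarrow> j < d \<Longrightarrow> (\<Sum>m<d. D i m * P m j) = (\<Sum>m<d. P i m * J m j)"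
    "\<And>i j. i < d \<Longrightarrow> j < d \<Longrightarrow> (\<Sum>m<d. Q i m * D m j) = (\<Sum>m<d. J i m * Q m j)"
    "\<And>i j. i < d \<Longrightarrow> j < d \<Longrightarrow> J i j \<noteq> 0 \<Longrightarrow> i \<le> j \<and> J i i = J j j"
proof -
  define A where "A = mat d d (\<lambda>(i, j). D i j)"
  have A: "A \<in> carrier_mat d d" by (simp add: A_def)
  obtain B where B: "B \<in> carrier_mat d d" "upper_triangular B" "similar_mat A B"
    using triangularizable[OF A] by blast
  obtain n_as where "jordan_nf B n_as" using triangular_to_jnf_vector[OF B(1,2)] by blast
  then have "similar_mat A (jordan_matrix n_as)"
    using B(3) similar_mat_trans unfolding jordan_nf_def by blast
  then obtain P Q where "similar_mat_wit A (jordan_matrix n_as) P Q"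
    unfolding similar_mat_def by blast
  note PQ = similar_mat_witD2[OF A this]
  define J where "J = jordan_matrix n_as"
  have J: "J \<in> carrier_mat d d" and AP: "A = P * J * Q" using PQ by (simp_all add: J_def)
  have dim: "sum_list (map fst n_as) = d"
    using J unfolding J_def carrier_mat_def by simp
  have "A * P = P * J * (Q * P)"
    unfolding AP by (rule assoc_mult_mat[OF mult_carrier_mat[OF PQ(6) J] PQ(7,6)])
  then have DP: "A * P = P * J" using PQ(2,6) J by simp
  have "Q * A = Q * (P * (J * Q))"
    unfolding AP using assoc_mult_mat[OF PQ(6) J PQ(7)] by simp
  also have "\<dots> = Q * P * (J * Q)"
    by (rule assoc_mult_mat[symmetric, OF PQ(7,6) mult_carrier_mat[OF J PQ(7)]])
  finally have QD: "Q * A = J * Q" using PQ(2,7) J by simp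
  note ix = index_mult_mat_sum[of _ d d _ d, symmetric]
  show ?thesis
  proof (rule that[where P = "\<lambda>i j. P $$ (i, j)" and Q = "\<lambda>i j. Q $$ (i, j)" and J = "\<lambda>i j. J $$ (i, j)"])
    fix i j assume ij: "i < d" "j < d"
    show "(\<Sum>a<d. Q $$ (i, a) * P $$ (a, j)) = (if i = j then 1 else 0)"
      using ij PQ(2) by (simp add: ix[OF PQ(7,6)])
    show "(\<Sum>a<d. P $$ (i, a) * Q $$ (a, j)) = (if i = j then 1 else 0)"
      using ij PQ(1) by (simp add: ix[OF PQ(6,7)])
    have "(\<Sum>m<d. D i m * P $$ (m, j)) = (\<Sum>m<d. A $$ (i, m) * P $$ (m, j))"
      using ij by (simp add: A_def)
    then show "(\<Sum>m<d. D i m * P $$ (m, j)) = (\<Sum>m<d. P $$ (i, m) * J $$ (m, j))"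
      using DP by (simp add: ix[OF A PQ(6) ij] ix[OF PQ(6) J ij])
    have "(\<Sum>m<d. Q $$ (i, m) * D m j) = (\<Sum>m<d. Q $$ (i, m) * A $$ (m, j))"
      using ij by (simp add: A_def)
    then show "(\<Sum>m<d. Q $$ (i, m) * D m j) = (\<Sum>m<d. J $$ (i, m) * Q $$ (m, j))"
      using QD by (simp add: ix[OF PQ(7) A ij] ix[OF J PQ(7) ij])
    assume "J $$ (i, j) \<noteq> 0"
    then show "i \<le> j \<and> J $$ (i, i) = J $$ (j, j)"
      unfolding J_def by (intro jordan_matrix_entry_nonzero) (use ij dim in auto)
  qed
qed

section \<open>Derivations in terms of structure constants\<close>

text \<open>For structure constants \<open>c a b e\<close> (the \<open>e\<close>-th coordinate of the product of the basis vectors \<open>a\<close>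
  and \<open>b\<close>), this is the pairing of the product of the vectors \<open>u\<close> and \<open>v\<close> with the covector \<open>w\<close>.
  Covectors are kept as a third argument so that a change of basis is uniform in all indices.\<close>

definition trilinear_form :: "nat \<Rightarrow> (nat \<Rightarrow> nat \<Rightarrow> nat \<Rightarrow> 'a::comm_ring_1) \<Rightarrow> (nat \<Rightarrow> 'a) \<Rightarrow> (nat \<Rightarrow> 'a) \<Rightarrow> (nat \<Rightarrow> 'a) \<Rightarrow> 'a"
  where "trilinear_form d c u v w = (\<Sum>a<d. \<Sum>b<d. \<Sum>e<d. c a b e * (u a * (v b * w e)))"

lemma trilinear_form_sum:
  "trilinear_form d c (\<lambda>a. \<Sum>i\<in>I. s i * f i a) v w = (\<Sum>i\<in>I. s i * trilinear_form d c (f i) v w)"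
  "trilinear_form d c u (\<lambda>a. \<Sum>i\<in>I. s i * f i a) w = (\<Sum>i\<in>I. s i * trilinear_form d c u (f i) w)"
  "trilinear_form d c u v (\<lambda>a. \<Sum>i\<in>I. s i * f i a) = (\<Sum>i\<in>I. s i * trilinear_form d c u v (f i))"
proof -
  have swap3: "(\<Sum>a<d. \<Sum>b<d. \<Sum>e<d. \<Sum>i\<in>I. g i a b e) = (\<Sum>i\<in>I. \<Sum>a<d. \<Sum>b<d. \<Sum>e<d. g i a b e)"
    for g :: "'b \<Rightarrow> nat \<Rightarrow> nat \<Rightarrow> nat \<Rightarrow> 'a"
    by (simp only: sum.swap[of _ I])
  show "trilinear_form d c (\<lambda>a. \<Sum>i\<in>I. s i * f i a) v w = (\<Sum>i\<in>I. s i * trilinear_form d c (f i) v w)"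
    "trilinear_form d c u (\<lambda>a. \<Sum>i\<in>I. s i * f i a) w = (\<Sum>i\<in>I. s i * trilinear_form d c u (f i) w)"
    "trilinear_form d c u v (\<lambda>a. \<Sum>i\<in>I. s i * f i a) = (\<Sum>i\<in>I. s i * trilinear_form d c u v (f i))"
    unfolding trilinear_form_def sum_distrib_left sum_distrib_right swap3
    by (simp_all only: mult_ac)
qed

lemma trilinear_form_cong:
  assumes "\<And>a. a < d \<Longrightarrow> u a = u' a" "\<And>a. a < d \<Longrightarrow> v a = v' a" "\<And>a. a < d \<Longrightarrow> w a = w' a"
  shows "trilinear_form d c u v w = trilinear_form d c u' v' w'"
  unfolding trilinear_form_def using assms by (intro sum.cong) auto

lemma trilinear_form_unit:
  assumes "i < d" "j < d" "k < d"
  shows "trilinear_form d c (\<lambda>a. if a = i then 1 else 0) (\<lambda>a. if a = j then 1 else 0) (\<lambda>a. if a = k then 1 else 0) = c i j k"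
proof -
  have [simp]: "(if b then 1 else 0) * x = (if b then x else 0)" "x * (if b then y else 0) = (if b then x * y else 0)"
    for b and x y :: 'a by simp_all
  have [simp]: "(\<Sum>m<d. if b then g m else 0) = (if b then \<Sum>m<d. g m else 0)" for b and g :: "nat \<Rightarrow> 'a"
    by simp
  show ?thesis unfolding trilinear_form_def using assms by simp
qed

text \<open>The column \<open>m\<close> of \<open>D\<close> holds the coordinates of the image of the \<open>m\<close>-th basis vector, and the
  equation compares the \<open>k\<close>-th coordinates of the two sides of the product rule for the basis
  vectors \<open>i\<close> and \<open>j\<close>.\<close>

definition derivation_matrix :: "nat \<Rightarrow> (nat \<Rightarrow> nat \<Rightarrow> nat \<Rightarrow> 'a::comm_ring_1) \<Rightarrow> (nat \<Rightarrow> nat \<Rightarrow> 'a) \<Rightarrow> bool"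
  where "derivation_matrix d c D \<longleftrightarrow> (\<forall>i<d. \<forall>j<d. \<forall>k<d.
    (\<Sum>m<d. D k m * c i j m) = (\<Sum>m<d. D m i * c m j k) + (\<Sum>m<d. D m j * c i m k))"

lemma derivation_matrix_trilinear:
  assumes "derivation_matrix d c D"
  shows "trilinear_form d c u v (\<lambda>e. \<Sum>k<d. w k * D k e) =
    trilinear_form d c (\<lambda>a. \<Sum>m<d. D a m * u m) v w + trilinear_form d c u (\<lambda>b. \<Sum>m<d. D b m * v m) w"
proof -
  have 1: "trilinear_form d c u v (\<lambda>e. \<Sum>k<d. w k * D k e) =
      (\<Sum>a<d. \<Sum>b<d. \<Sum>k<d. u a * (v b * (w k * (\<Sum>e<d. D k e * c a b e))))"
    unfolding trilinear_form_def sum_distrib_left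
    by (rule sum.cong[OF refl], rule sum.cong[OF refl], subst sum.swap) (simp add: mult_ac)
  have "trilinear_form d c (\<lambda>a. \<Sum>m<d. D a m * u m) v w =
      (\<Sum>m<d. u m * trilinear_form d c (\<lambda>a. D a m) v w)"
    by (simp only: trilinear_form_sum[symmetric] mult.commute)
  also have "\<dots> = (\<Sum>a<d. \<Sum>b<d. \<Sum>k<d. u a * (v b * (w k * (\<Sum>m<d. D m a * c m b k))))"
  proof (rule sum.cong[OF refl])
    fix a
    have "trilinear_form d c (\<lambda>m. D m a) v w = (\<Sum>b<d. \<Sum>k<d. \<Sum>m<d. c m b k * (D m a * (v b * w k)))"
      unfolding trilinear_form_def by (subst sum.swap, rule sum.cong[OF refl], rule sum.swap)
    then show "u a * trilinear_form d c (\<lambda>m. D m a) v w =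
        (\<Sum>b<d. \<Sum>k<d. u a * (v b * (w k * (\<Sum>m<d. D m a * c m b k))))"
      by (simp add: sum_distrib_left mult_ac)
  qed
  finally have 2: "trilinear_form d c (\<lambda>a. \<Sum>m<d. D a m * u m) v w = \<dots>" .
  have "trilinear_form d c u (\<lambda>b. \<Sum>m<d. D b m * v m) w =
      (\<Sum>m<d. v m * trilinear_form d c u (\<lambda>b. D b m) w)"
    by (simp only: trilinear_form_sum[symmetric] mult.commute)
  also have "\<dots> = (\<Sum>b<d. \<Sum>a<d. \<Sum>k<d. u a * (v b * (w k * (\<Sum>m<d. D m b * c a m k))))"
  proof (rule sum.cong[OF refl])
    fix b
    have "trilinear_form d c u (\<lambda>m. D m b) w = (\<Sum>a<d. \<Sum>k<d. \<Sum>m<d. c a m k * (u a * (D m b * w k)))"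
      unfolding trilinear_form_def by (rule sum.cong[OF refl], rule sum.swap)
    then show "v b * trilinear_form d c u (\<lambda>m. D m b) w =
        (\<Sum>a<d. \<Sum>k<d. u a * (v b * (w k * (\<Sum>m<d. D m b * c a m k))))"
      by (simp add: sum_distrib_left mult_ac)
  qed
  also have "\<dots> = (\<Sum>a<d. \<Sum>b<d. \<Sum>k<d. u a * (v b * (w k * (\<Sum>m<d. D m b * c a m k))))"
    by (rule sum.swap)
  finally have 3: "trilinear_form d c u (\<lambda>b. \<Sum>m<d. D b m * v m) w = \<dots>" .
  show ?thesis
    unfolding 1 2 3 sum.distrib[symmetric]
    using assms by (intro sum.cong refl) (simp add: derivation_matrix_def distrib_left)
qed

text \<open>The condition on a derivation is invariant under a change of basis. Only the intertwining relations
  are assumed of \<open>P\<close> and \<open>Q\<close>, so the lemma serves for passing to a Jordan basis and, with the two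
  exchanged, for returning from it.\<close>

lemma derivation_matrix_change_basis:
  assumes D: "derivation_matrix d c D"
    and DP: "\<And>i j. i < d \<Longrightarrow> j < d \<Longrightarrow> (\<Sum>m<d. D i m * P m j) = (\<Sum>m<d. P i m * J m j)"
    and QD: "\<And>i j. i < d \<Longrightarrow> j < d \<Longrightarrow> (\<Sum>m<d. Q i m * D m j) = (\<Sum>m<d. J i m * Q m j)"
    and f: "\<And>i j k. i < d \<Longrightarrow> j < d \<Longrightarrow> k < d \<Longrightarrow>
      f i j k = trilinear_form d c (\<lambda>a. P a i) (\<lambda>b. P b j) (Q k)"
  shows "derivation_matrix d f J"
  unfolding derivation_matrix_def
proof (intro allI impI)
  fix i j k assume ijk: "i < d" "j < d" "k < d"
  let ?T = "trilinear_form d c"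
  have "(\<Sum>m<d. J k m * f i j m) = ?T (\<lambda>a. P a i) (\<lambda>b. P b j) (\<lambda>e. \<Sum>m<d. J k m * Q m e)"
    using ijk by (simp add: trilinear_form_sum f)
  also have "\<dots> = ?T (\<lambda>a. P a i) (\<lambda>b. P b j) (\<lambda>e. \<Sum>m<d. Q k m * D m e)"
    by (rule trilinear_form_cong) (simp_all add: QD ijk)
  also have "\<dots> = ?T (\<lambda>a. \<Sum>m<d. D a m * P m i) (\<lambda>b. P b j) (Q k) +
      ?T (\<lambda>a. P a i) (\<lambda>b. \<Sum>m<d. D b m * P m j) (Q k)"
    by (rule derivation_matrix_trilinear[OF D])
  also have "?T (\<lambda>a. \<Sum>m<d. D a m * P m i) (\<lambda>b. P b j) (Q k) =
      ?T (\<lambda>a. \<Sum>m<d. J m i * P a m) (\<lambda>b. P b j) (Q k)"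
    by (rule trilinear_form_cong) (simp_all add: DP ijk mult.commute)
  also have "\<dots> = (\<Sum>m<d. J m i * f m j k)"
    using ijk by (simp add: trilinear_form_sum f)
  also have "?T (\<lambda>a. P a i) (\<lambda>b. \<Sum>m<d. D b m * P m j) (Q k) =
      ?T (\<lambda>a. P a i) (\<lambda>b. \<Sum>m<d. J m j * P b m) (Q k)"
    by (rule trilinear_form_cong) (simp_all add: DP ijk mult.commute)
  also have "\<dots> = (\<Sum>m<d. J m j * f i m k)"
    using ijk by (simp add: trilinear_form_sum f)
  finally show "(\<Sum>m<d. J k m * f i j m) = (\<Sum>m<d. J m i * f m j k) + (\<Sum>m<d. J m j * f i m k)" .
qed

lemma trilinear_form_change_basis:
  assumes "\<And>i j k. i < d \<Longrightarrow> j < d \<Longrightarrow> k < d \<Longrightarrow>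
      f i j k = trilinear_form d c (\<lambda>a. P a i) (\<lambda>b. P b j) (Q k)"
  shows "trilinear_form d f u v w =
    trilinear_form d c (\<lambda>a. \<Sum>i<d. u i * P a i) (\<lambda>b. \<Sum>j<d. v j * P b j) (\<lambda>e. \<Sum>k<d. w k * Q k e)"
  unfolding trilinear_form_sum unfolding trilinear_form_def[of d f]
  by (simp add: assms sum_distrib_left mult_ac)

text \<open>The generalized eigenspaces of a derivation grade the algebra. For a triangular matrix that does
  not mix eigenvalues this needs no binomial expansion: in a violating triple with \<open>i + j - k\<close>
  minimal, every off-diagonal contribution to the derivation identity involves a smaller violating
  triple and vanishes, so that the diagonal part alone reads
  \<open>(J k k - J i i - J j j) f i j k = 0\<close>.\<close>

lemma derivation_matrix_triangular_graded:
  fixes f :: "nat \<Rightarrow> nat \<Rightarrow> nat \<Rightarrow> 'a::field"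
  assumes J: "derivation_matrix d f J"
    and tri: "\<And>i j. i < d \<Longrightarrow> j < d \<Longrightarrow> J i j \<noteq> 0 \<Longrightarrow> i \<le> j \<and> J i i = J j j"
    and ijk: "i < d" "j < d" "k < d" "f i j k \<noteq> 0"
  shows "J k k = J i i + J j j"
  using ijk
proof (induction "i + j + (d - k)" arbitrary: i j k rule: less_induct)
  case less
  show ?case
  proof (rule ccontr)
    assume neq: "J k k \<noteq> J i i + J j j"
    have "J k m * f i j m = (if m = k then J k k * f i j k else 0)" if "m < d" for m
    proof (cases "J k m = 0 \<or> m = k")
      case False
      with tri[of k m] less.prems that have m: "k < m" "J m m = J k k" by auto
      with less.hyps[of i j m] less.prems that neq have "f i j m = 0" by fastforce
      with False show ?thesis by simp
    qed auto
    then have "(\<Sum>m<d. J k m * f i j m) = (\<Sum>m<d. if m = k then J k k * f i j k else 0)"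
      by (intro sum.cong refl) (simp only: lessThan_iff)
    then have 1: "(\<Sum>m<d. J k m * f i j m) = J k k * f i j k" using less.prems(3) by simp
    have "J m i * f m j k = (if m = i then J i i * f i j k else 0)" if "m < d" for m
    proof (cases "J m i = 0 \<or> m = i")
      case False
      with tri[of m i] less.prems that have m: "m < i" "J m m = J i i" by auto
      with less.hyps[of m j k] less.prems that neq have "f m j k = 0" by fastforce
      with False show ?thesis by simp
    qed auto
    then have "(\<Sum>m<d. J m i * f m j k) = (\<Sum>m<d. if m = i then J i i * f i j k else 0)"
      by (intro sum.cong refl) (simp only: lessThan_iff)
    then have 2: "(\<Sum>m<d. J m i * f m j k) = J i i * f i j k" using less.prems(1) by simp
    have "J m j * f i m k = (if m = j then J j j * f i j k else 0)" if "m < d" for m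
    proof (cases "J m j = 0 \<or> m = j")
      case False
      with tri[of m j] less.prems that have m: "m < j" "J m m = J j j" by auto
      with less.hyps[of i m k] less.prems that neq have "f i m k = 0" by fastforce
      with False show ?thesis by simp
    qed auto
    then have "(\<Sum>m<d. J m j * f i m k) = (\<Sum>m<d. if m = j then J j j * f i j k else 0)"
      by (intro sum.cong refl) (simp only: lessThan_iff)
    then have 3: "(\<Sum>m<d. J m j * f i m k) = J j j * f i j k" using less.prems(2) by simp
    have "J k k * f i j k = J i i * f i j k + J j j * f i j k"
      using J less.prems unfolding derivation_matrix_def 1[symmetric] 2[symmetric] 3[symmetric] by blast
    with neq less.prems show False by (simp add: distrib_right[symmetric])
  qed
qed

section \<open>Trace-orthogonal derivations are nilpotent\<close>

lemma (in vector_space) ex_linear_functional: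
  assumes S: "subspace S" and x: "x \<notin> S"
  obtains f where "Vector_Spaces.linear scale (*) f" "f x = 1" "\<And>s. s \<in> S \<Longrightarrow> f s = 0"
proof -
  obtain B where B: "B \<subseteq> S" "independent B" "S \<subseteq> span B"
    using maximal_independent_subset[of S] by blast
  have "span B = S" using B S by (metis span_eq_iff span_mono subset_antisym)
  then have ind: "independent (insert x B)" using x B by (simp add: independent_insert)
  define E where "E = extend_basis (insert x B)"
  have E: "insert x B \<subseteq> E" "independent E" "span E = UNIV"
    unfolding E_def using extend_basis_superset[OF ind] independent_extend_basis[OF ind]
      span_extend_basis[OF ind] by auto
  show ?thesis
  proof (rule that[of "\<lambda>v. representation E v x"])
    show "Vector_Spaces.linear scale (*) (\<lambda>v. representation E v x)"
      by (rule linear_representation[OF E(2,3)])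
    show "representation E x x = 1"
      using representation_basis[OF E(2), of x] E(1) by simp
    fix s assume "s \<in> S"
    then have s: "s \<in> span B" using B by blast
    have "representation E s = representation B s"
      by (rule representation_extend[OF E(2) s]) (use E(1) in auto)
    moreover have "x \<notin> B" using x B by blast
    ultimately show "representation E s x = 0" using representation_ne_zero by metis
  qed
qed

text \<open>The core of Cartan's criterion. If some eigenvalue is nonzero, choose a \<open>\<rat>\<close>-linear map \<open>\<phi>\<close> to the
  rationals that does not kill it, and let \<open>Y\<close> act as \<open>\<phi>(a)\<close> on the generalized eigenspace of \<open>a\<close>.
  Additivity of \<open>\<phi>\<close> and the grading make \<open>Y\<close> a derivation, and the trace of \<open>D Y\<close> is
  \<open>\<Sum> a \<phi>(a)\<close> over the eigenvalues with multiplicity. This cannot vanish, because its image under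
  \<open>\<phi>\<close> is a sum of squares of rationals that are not all zero.\<close>

lemma derivation_matrix_nilpotent:
  fixes D :: "nat \<Rightarrow> nat \<Rightarrow> 'a::{alg_closed_field, field_char_0}"
  assumes D: "derivation_matrix d c D"
    and orth: "\<And>Y. derivation_matrix d c Y \<Longrightarrow> (\<Sum>i<d. \<Sum>m<d. D i m * Y m i) = 0"
    and a: "a < d"
  shows "((\<lambda>u k. \<Sum>m<d. D k m * u m) ^^ d) u a = 0"
proof -
  obtain P Q J where
      QP: "\<And>i j. i < d \<Longrightarrow> j < d \<Longrightarrow> (\<Sum>a<d. Q i a * P a j) = (if i = j then 1 else 0)"
    and PQ: "\<And>i j. i < d \<Longrightarrow> j < d \<Longrightarrow> (\<Sum>a<d. P i a * Q a j) = (if i = j then 1 else 0)"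
    and DP: "\<And>i j. i < d \<Longrightarrow> j < d \<Longrightarrow> (\<Sum>m<d. D i m * P m j) = (\<Sum>m<d. P i m * J m j)"
    and QD: "\<And>i j. i < d \<Longrightarrow> j < d \<Longrightarrow> (\<Sum>m<d. Q i m * D m j) = (\<Sum>m<d. J i m * Q m j)"
    and tri: "\<And>i j. i < d \<Longrightarrow> j < d \<Longrightarrow> J i j \<noteq> 0 \<Longrightarrow> i \<le> j \<and> J i i = J j j"
    by (rule jordan_basis[of d D]) (rule that; assumption)
  define f where "f i j k = trilinear_form d c (\<lambda>a. P a i) (\<lambda>b. P b j) (Q k)" for i j k
  have J: "derivation_matrix d f J"
    by (rule derivation_matrix_change_basis[OF D DP QD f_def])
  have c_eq: "c i j k = trilinear_form d f (\<lambda>a. Q a i) (\<lambda>b. Q b j) (P k)" if "i < d" "j < d" "k < d" for i j k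
  proof -
    have "trilinear_form d f (\<lambda>a. Q a i) (\<lambda>b. Q b j) (P k) =
      trilinear_form d c (\<lambda>a. if a = i then 1 else 0) (\<lambda>a. if a = j then 1 else 0) (\<lambda>a. if a = k then 1 else 0)"
      unfolding trilinear_form_change_basis[OF f_def]
      by (rule trilinear_form_cong) (use that PQ in \<open>auto simp: mult.commute[of "Q _ _"]\<close>)
    then show ?thesis using that trilinear_form_unit by metis
  qed
  have ev0: "J r r = 0" if r: "r < d" for r
  proof (rule ccontr)
    assume nz: "J r r \<noteq> 0"
    interpret Q: vector_space "\<lambda>(q::rat) (z::'a). of_rat q * z"
      by unfold_locales (simp_all add: algebra_simps of_rat_add of_rat_mult)
    obtain \<phi> where \<phi>: "Vector_Spaces.linear (\<lambda>(q::rat) (z::'a). of_rat q * z) (*) \<phi>" and \<phi>1: "\<phi> (J r r) = 1"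
      using Q.ex_linear_functional[of "{0}" "J r r"] nz Q.subspace_single_0 by blast
    interpret \<phi>: Vector_Spaces.linear "\<lambda>(q::rat) (z::'a). of_rat q * z" "(*)" \<phi> by (rule \<phi>)
    define \<theta> where "\<theta> i = (of_rat (\<phi> (J i i)) :: 'a)" for i
    define \<Phi> where "\<Phi> i j = (if i = j then \<theta> i else 0)" for i j :: nat
    define Y where "Y a b = (\<Sum>i<d. P a i * (\<theta> i * Q i b))" for a b
    have "derivation_matrix d f \<Phi>"
      unfolding derivation_matrix_def
    proof (intro allI impI)
      fix i j k assume ijk: "i < d" "j < d" "k < d"
      have "\<theta> k * f i j k = \<theta> i * f i j k + \<theta> j * f i j k"
      proof (cases "f i j k = 0")
        case False
        then have "J k k = J i i + J j j"
          using derivation_matrix_triangular_graded[OF J tri ijk] by blast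
        then show ?thesis by (simp add: \<theta>_def \<phi>.add of_rat_add distrib_right)
      qed simp
      moreover have "(\<Sum>m<d. \<Phi> l m * g m) = \<theta> l * g l" "(\<Sum>m<d. \<Phi> m l * g m) = \<theta> l * g l"
        if "l < d" for l g
        using that by (simp_all add: \<Phi>_def if_distrib[of "\<lambda>z. z * _"] cong: if_cong)
      ultimately show "(\<Sum>m<d. \<Phi> k m * f i j m) = (\<Sum>m<d. \<Phi> m i * f m j k) + (\<Sum>m<d. \<Phi> m j * f i m k)"
        using ijk by simp
    qed
    then have Y: "derivation_matrix d c Y"
    proof (rule derivation_matrix_change_basis[where P = Q and Q = P])
      fix i j assume ij: "i < d" "j < d"
      have "(\<Sum>m<d. Q i m * Y m j) = (\<Sum>l<d. \<Sum>m<d. Q i m * (P m l * (\<theta> l * Q l j)))"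
        unfolding Y_def sum_distrib_left by (rule sum.swap)
      also have "\<dots> = (\<Sum>l<d. (\<Sum>m<d. Q i m * P m l) * (\<theta> l * Q l j))"
        by (simp add: sum_distrib_right mult.assoc)
      also have "\<dots> = \<theta> i * Q i j"
        using ij by (simp add: QP if_distrib[of "\<lambda>z. z * _"] cong: if_cong)
      finally show "(\<Sum>m<d. \<Phi> i m * Q m j) = (\<Sum>m<d. Q i m * Y m j)"
        using ij by (simp add: \<Phi>_def if_distrib[of "\<lambda>z. z * _"] cong: if_cong)
      have "(\<Sum>m<d. Y i m * P m j) = (\<Sum>l<d. \<Sum>m<d. P i l * (\<theta> l * Q l m) * P m j)"
        unfolding Y_def sum_distrib_right by (rule sum.swap)
      also have "\<dots> = (\<Sum>l<d. P i l * \<theta> l * (\<Sum>m<d. Q l m * P m j))"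
        by (simp add: sum_distrib_left mult.assoc)
      also have "\<dots> = P i j * \<theta> j"
        using ij by (simp add: QP if_distrib[of "\<lambda>z. _ * z"] cong: if_cong)
      finally show "(\<Sum>m<d. P i m * \<Phi> m j) = (\<Sum>m<d. Y i m * P m j)"
        using ij by (simp add: \<Phi>_def if_distrib[of "\<lambda>z. _ * z"] cong: if_cong)
    qed (rule c_eq)
    have "(\<Sum>i<d. \<Sum>m<d. D i m * Y m i) = (\<Sum>i<d. \<Sum>m<d. \<Sum>l<d. D i m * (P m l * (\<theta> l * Q l i)))"
      unfolding Y_def by (simp add: sum_distrib_left)
    also have "\<dots> = (\<Sum>i<d. \<Sum>l<d. \<Sum>m<d. D i m * (P m l * (\<theta> l * Q l i)))"
      by (intro sum.cong[OF refl] sum.swap)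
    also have "\<dots> = (\<Sum>l<d. \<Sum>i<d. \<Sum>m<d. D i m * (P m l * (\<theta> l * Q l i)))"
      by (rule sum.swap)
    also have "\<dots> = (\<Sum>l<d. \<theta> l * (\<Sum>i<d. Q l i * (\<Sum>m<d. D i m * P m l)))"
      by (simp add: sum_distrib_left mult_ac)
    also have "\<dots> = (\<Sum>l<d. \<theta> l * J l l)"
    proof (rule sum.cong[OF refl])
      fix l assume l: "l \<in> {..<d}"
      have "(\<Sum>i<d. Q l i * (\<Sum>m<d. D i m * P m l)) = (\<Sum>i<d. \<Sum>k<d. Q l i * (P i k * J k l))"
        using l by (simp add: DP sum_distrib_left)
      also have "\<dots> = (\<Sum>k<d. \<Sum>i<d. Q l i * (P i k * J k l))"
        by (rule sum.swap)
      also have "\<dots> = (\<Sum>k<d. (\<Sum>i<d. Q l i * P i k) * J k l)"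
        by (simp add: sum_distrib_right mult.assoc)
      also have "\<dots> = J l l"
        using l by (simp add: QP if_distrib[of "\<lambda>z. z * _"] cong: if_cong)
      finally show "\<theta> l * (\<Sum>i<d. Q l i * (\<Sum>m<d. D i m * P m l)) = \<theta> l * J l l" by simp
    qed
    finally have "(\<Sum>l<d. \<theta> l * J l l) = 0" using orth[OF Y] by simp
    \<comment> \<open>Each \<open>\<theta> l\<close> is rational, so \<open>\<phi>\<close> turns the trace into a sum of squares.\<close>
    then have "\<phi> (\<Sum>l<d. \<theta> l * J l l) = 0" using \<phi>.zero by simp
    then have "(\<Sum>l<d. \<phi> (J l l) * \<phi> (J l l)) = 0"
      by (simp add: \<phi>.sum \<theta>_def \<phi>.scale)
    then have "\<phi> (J r r) * \<phi> (J r r) = 0"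
      using r by (subst (asm) sum_nonneg_eq_0_iff) auto
    with \<phi>1 show False by simp
  qed
  let ?D = "\<lambda>u k. \<Sum>m<d. D k m * u m"
  \<comment> \<open>With all eigenvalues zero, \<open>J\<close> is strictly upper triangular: each application of \<open>D\<close> clears one
    more coordinate, from the last one down.\<close>
  have nil: "(\<Sum>m<d. Q k m * (?D ^^ n) u m) = 0" if "k < d" "d \<le> k + n" for n k
    using that
  proof (induction n arbitrary: k)
    case (Suc n)
    have "(\<Sum>m<d. Q k m * (?D ^^ Suc n) u m) = (\<Sum>m<d. \<Sum>l<d. Q k m * (D m l * (?D ^^ n) u l))"
      by (simp add: sum_distrib_left)
    also have "\<dots> = (\<Sum>l<d. \<Sum>m<d. Q k m * (D m l * (?D ^^ n) u l))"
      by (rule sum.swap)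
    also have "\<dots> = (\<Sum>l<d. (\<Sum>m<d. Q k m * D m l) * (?D ^^ n) u l)"
      by (simp add: sum_distrib_right mult.assoc)
    also have "\<dots> = (\<Sum>l<d. \<Sum>m<d. J k m * (Q m l * (?D ^^ n) u l))"
      using Suc.prems by (simp add: QD sum_distrib_right mult.assoc)
    also have "\<dots> = (\<Sum>m<d. \<Sum>l<d. J k m * (Q m l * (?D ^^ n) u l))"
      by (rule sum.swap)
    also have "\<dots> = (\<Sum>m<d. J k m * (\<Sum>l<d. Q m l * (?D ^^ n) u l))"
      by (simp add: sum_distrib_left)
    also have "\<dots> = 0"
    proof (rule sum.neutral, intro ballI)
      fix m assume m: "m \<in> {..<d}"
      show "J k m * (\<Sum>l<d. Q m l * (?D ^^ n) u l) = 0"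
      proof (cases "J k m = 0")
        case False
        with tri[of k m] ev0[of k] m Suc.prems have "k < m" by (cases "k = m") auto
        then have "(\<Sum>l<d. Q m l * (?D ^^ n) u l) = 0" using Suc.IH[of m] m Suc.prems by simp
        then show ?thesis by (simp only: mult_zero_right)
      qed simp
    qed
    finally show ?case .
  qed simp
  have "(?D ^^ d) u a = (\<Sum>l<d. (if a = l then 1 else 0) * (?D ^^ d) u l)"
    using a by (simp add: if_distrib[of "\<lambda>z. z * _"] cong: if_cong)
  also have "\<dots> = (\<Sum>l<d. \<Sum>m<d. P a m * (Q m l * (?D ^^ d) u l))"
    using a by (intro sum.cong refl) (simp add: PQ[symmetric] sum_distrib_right mult.assoc)
  also have "\<dots> = (\<Sum>m<d. \<Sum>l<d. P a m * (Q m l * (?D ^^ d) u l))"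
    by (rule sum.swap)
  also have "\<dots> = (\<Sum>m<d. P a m * (\<Sum>l<d. Q m l * (?D ^^ d) u l))"
    by (simp add: sum_distrib_left)
  also have "\<dots> = 0"
    by (rule sum.neutral) (simp add: nil)
  finally show ?thesis .
qed

locale finite_dim_algebra = finite_dimensional_vector_space scale Basis
  for scale :: "'k::field_char_0 \<Rightarrow> 'v::ab_group_add \<Rightarrow> 'v" (infixr "*s" 75) and Basis +
  fixes mult :: "'v \<Rightarrow> 'v \<Rightarrow> 'v"
  assumes linear_mult_left: "\<And>y. Vector_Spaces.linear (*s) (*s) (\<lambda>x. mult x y)"
    and linear_mult_right: "\<And>x. Vector_Spaces.linear (*s) (*s) (\<lambda>y. mult x y)"
begin

definition trace :: "('v \<Rightarrow> 'v) \<Rightarrow> 'k" where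
  "trace f = (\<Sum>b\<in>Basis. representation Basis (f b) b)"

definition derivation :: "('v \<Rightarrow> 'v) \<Rightarrow> bool" where
  "derivation \<delta> \<longleftrightarrow> Vector_Spaces.linear (*s) (*s) \<delta> \<and> (\<forall>x y. \<delta> (mult x y) = mult (\<delta> x) y + mult x (\<delta> y))"

lemma linear_coordinate: "Vector_Spaces.linear (*s) (*) (\<lambda>v. representation Basis v b)"
  by (rule linear_representation[OF independent_Basis span_Basis])

lemma coordinate_simps:
  "representation Basis (v + w) b = representation Basis v b + representation Basis w b"
  "representation Basis (c *s v) b = c * representation Basis v b"
  "representation Basis (v - w) b = representation Basis v b - representation Basis w b"
  "representation Basis (\<Sum>i\<in>I. g i) b = (\<Sum>i\<in>I. representation Basis (g i) b)"
proof -
  interpret c: Vector_Spaces.linear "(*s)" "(*)" "\<lambda>v. representation Basis v b" by (rule linear_coordinate)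
  show "representation Basis (v + w) b = representation Basis v b + representation Basis w b"
  "representation Basis (c *s v) b = c * representation Basis v b"
  "representation Basis (v - w) b = representation Basis v b - representation Basis w b"
  "representation Basis (\<Sum>i\<in>I. g i) b = (\<Sum>i\<in>I. representation Basis (g i) b)"
    by (rule c.add c.scale c.diff c.sum)+
qed

lemma coordinate_expand: "(\<Sum>b\<in>Basis. representation Basis v b *s b) = v"
  by (rule sum_representation_eq[OF independent_Basis]) (auto simp: span_Basis finite_Basis)

lemma coordinate_basis: "b \<in> Basis \<Longrightarrow> representation Basis b c = (if c = b then 1 else 0)"
  by (simp add: representation_basis[OF independent_Basis])

lemma trace_linear_combination:
  "trace (\<lambda>x. f x - g x) = trace f - trace g"
  "trace (\<lambda>x. \<Sum>i\<in>I. c i *s h i x) = (\<Sum>i\<in>I. c i * trace (h i))"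
  unfolding trace_def coordinate_simps
  by (simp_all add: sum_subtractf sum_distrib_left sum.swap[of _ I])

lemma trace_comp_commute:
  assumes f: "Vector_Spaces.linear (*s) (*s) f" and g: "Vector_Spaces.linear (*s) (*s) g"
  shows "trace (\<lambda>x. f (g x)) = trace (\<lambda>x. g (f x))"
proof -
  have expand: "trace (\<lambda>x. p (q x)) =
      (\<Sum>b\<in>Basis. \<Sum>c\<in>Basis. representation Basis (q b) c * representation Basis (p c) b)"
    if "Vector_Spaces.linear (*s) (*s) p" for p q :: "'v \<Rightarrow> 'v"
  proof -
    interpret p: Vector_Spaces.linear "(*s)" "(*s)" p by (rule that)
    have "p (q b) = (\<Sum>c\<in>Basis. representation Basis (q b) c *s p c)" for b
      by (subst coordinate_expand[of "q b", symmetric]) (simp add: p.sum p.scale)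
    then show ?thesis unfolding trace_def by (simp add: coordinate_simps)
  qed
  show ?thesis unfolding expand[OF f] expand[OF g] by (subst sum.swap) (simp add: mult.commute)
qed

text \<open>The matrix statement over the algebraic closure descends to the ground field. A derivation \<open>Y\<close>
  over the closure is a solution of linear equations with coefficients in the ground field, so
  applying a linear functional \<open>l\<close> of the closure to all entries of \<open>Y\<close> gives a derivation of the
  algebra itself, and \<open>l\<close> commutes with the trace against \<open>D\<close>.\<close>

theorem derivation_nilpotent:
  assumes D: "derivation D"
    and orth: "\<And>\<delta>. derivation \<delta> \<Longrightarrow> trace (\<lambda>x. D (\<delta> x)) = 0"
  shows "\<exists>n. \<forall>x. (D ^^ n) x = 0"
proof -
  define d where "d = card Basis"
  obtain e where e: "bij_betw e {..<d} Basis"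
    using ex_bij_betw_nat_finite[OF finite_Basis] unfolding d_def atLeast0LessThan by blast
  then have eB: "e i \<in> Basis" if "i < d" for i using that by (auto simp: bij_betw_def)
  have reindex: "(\<Sum>b\<in>Basis. g b) = (\<Sum>i<d. g (e i))" for g :: "'v \<Rightarrow> 'b::comm_monoid_add"
    by (rule sum.reindex_bij_betw[OF e, symmetric])
  define co where "co i v = representation Basis v (e i)" for i v
  note co_simps = coordinate_simps[where b = "e _", folded co_def]
  have expand: "v = (\<Sum>i<d. co i v *s e i)" for v
    using coordinate_expand[of v] by (simp add: reindex co_def)
  have co_e: "co i (e j) = (if i = j then 1 else 0)" if "i < d" "j < d" for i j
    using coordinate_basis[OF eB[OF that(2)], of "e i"] e that
    by (auto simp: co_def bij_betw_def inj_on_def)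
  have eqI: "v = w" if "\<And>i. i < d \<Longrightarrow> co i v = co i w" for v w
  proof -
    have "(\<Sum>i<d. co i v *s e i) = (\<Sum>i<d. co i w *s e i)"
      by (intro sum.cong refl) (simp add: that)
    then show ?thesis by (simp only: expand[symmetric])
  qed
  interpret D: Vector_Spaces.linear "(*s)" "(*s)" D using D by (simp add: derivation_def)
  define c where "c i j k = co k (mult (e i) (e j))" for i j k
  define M where "M k i = co k (D (e i))" for k i
  have mult_sum: "mult (\<Sum>i\<in>I. s i *s x i) y = (\<Sum>i\<in>I. s i *s mult (x i) y)"
    "mult y (\<Sum>i\<in>I. s i *s x i) = (\<Sum>i\<in>I. s i *s mult y (x i))" for s x y and I :: "nat set"
  proof -
    interpret l: Vector_Spaces.linear "(*s)" "(*s)" "\<lambda>x. mult x y" by (rule linear_mult_left)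
    interpret r: Vector_Spaces.linear "(*s)" "(*s)" "\<lambda>x. mult y x" by (rule linear_mult_right)
    show "mult (\<Sum>i\<in>I. s i *s x i) y = (\<Sum>i\<in>I. s i *s mult (x i) y)"
      "mult y (\<Sum>i\<in>I. s i *s x i) = (\<Sum>i\<in>I. s i *s mult y (x i))"
      by (simp_all add: l.sum l.scale r.sum r.scale)
  qed
  have co_D: "co k (D v) = (\<Sum>m<d. M k m * co m v)" for k v
    by (subst expand[of v]) (simp add: D.sum D.scale co_simps M_def mult.commute)
  have M: "derivation_matrix d c M"
    unfolding derivation_matrix_def
  proof (intro allI impI)
    fix i j k assume "i < d" "j < d" "k < d"
    have "(\<Sum>m<d. M k m * c i j m) = co k (D (mult (e i) (e j)))"
      by (simp add: co_D c_def)
    also have "\<dots> = co k (mult (D (e i)) (e j)) + co k (mult (e i) (D (e j)))"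
      using D by (simp add: derivation_def co_simps)
    also have "D (e i) = (\<Sum>m<d. M m i *s e m)" unfolding M_def by (rule expand)
    also have "D (e j) = (\<Sum>m<d. M m j *s e m)" unfolding M_def by (rule expand)
    finally show "(\<Sum>m<d. M k m * c i j m) = (\<Sum>m<d. M m i * c m j k) + (\<Sum>m<d. M m j * c i m k)"
      by (simp add: mult_sum co_simps c_def)
  qed
  have tri: "(\<Sum>k<d. w k * co k (mult x y)) = trilinear_form d c (\<lambda>i. co i x) (\<lambda>i. co i y) w" for w x y
  proof -
    have "co k (mult x y) = (\<Sum>i<d. \<Sum>j<d. co i x * (co j y * c i j k))" for k
      by (subst expand[of x], unfold mult_sum(1), subst expand[of y], unfold mult_sum(2))
        (simp add: co_simps c_def sum_distrib_left)
    then have "(\<Sum>k<d. w k * co k (mult x y)) = (\<Sum>k<d. \<Sum>i<d. \<Sum>j<d. c i j k * (co i x * (co j y * w k)))"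
      by (simp add: sum_distrib_left mult_ac)
    also have "\<dots> = (\<Sum>i<d. \<Sum>k<d. \<Sum>j<d. c i j k * (co i x * (co j y * w k)))"
      by (rule sum.swap)
    also have "\<dots> = (\<Sum>i<d. \<Sum>j<d. \<Sum>k<d. c i j k * (co i x * (co j y * w k)))"
      by (rule sum.cong[OF refl], rule sum.swap)
    finally show ?thesis unfolding trilinear_form_def .
  qed
  have trace_0: "(\<Sum>i<d. \<Sum>m<d. M i m * Y m i) = 0" if Y: "derivation_matrix d c Y" for Y
  proof -
    define \<delta> where "\<delta> v = (\<Sum>m<d. (\<Sum>i<d. Y m i * co i v) *s e m)" for v
    have co_\<delta>: "co k (\<delta> v) = (\<Sum>i<d. Y k i * co i v)" if "k < d" for k v
      unfolding \<delta>_def using that by (simp add: co_simps co_e if_distrib[of "\<lambda>z. _ * z"] cong: if_cong)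
    have "derivation \<delta>"
      unfolding derivation_def
    proof (intro conjI allI)
      show "Vector_Spaces.linear (*s) (*s) \<delta>"
        unfolding Vector_Spaces.linear_iff
        by (auto simp: vector_space_axioms \<delta>_def co_simps distrib_left sum.distrib scale_left_distrib
            scale_sum_right sum_distrib_left mult_ac)
      fix x y
      show "\<delta> (mult x y) = mult (\<delta> x) y + mult x (\<delta> y)"
      proof (rule eqI)
        fix k assume k: "k < d"
        define w where "w = (\<lambda>i. if i = k then 1 else (0::'k))"
        have w: "(\<Sum>i<d. w i * g i) = g k" for g
          using k by (simp add: w_def if_distrib[of "\<lambda>z. z * _"] cong: if_cong)
        have "co k (\<delta> (mult x y)) = (\<Sum>e<d. (\<Sum>i<d. w i * Y i e) * co e (mult x y))"
          using k by (simp add: w co_\<delta>)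
        also have "\<dots> = trilinear_form d c (\<lambda>a. \<Sum>m<d. Y a m * co m x) (\<lambda>i. co i y) w +
            trilinear_form d c (\<lambda>i. co i x) (\<lambda>b. \<Sum>m<d. Y b m * co m y) w"
          unfolding tri by (rule derivation_matrix_trilinear[OF Y])
        also have "trilinear_form d c (\<lambda>a. \<Sum>m<d. Y a m * co m x) (\<lambda>i. co i y) w =
            trilinear_form d c (\<lambda>i. co i (\<delta> x)) (\<lambda>i. co i y) w"
          by (rule trilinear_form_cong) (simp_all add: co_\<delta>)
        also have "trilinear_form d c (\<lambda>i. co i x) (\<lambda>b. \<Sum>m<d. Y b m * co m y) w =
            trilinear_form d c (\<lambda>i. co i x) (\<lambda>i. co i (\<delta> y)) w"
          by (rule trilinear_form_cong) (simp_all add: co_\<delta>)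
        finally show "co k (\<delta> (mult x y)) = co k (mult (\<delta> x) y + mult x (\<delta> y))"
          unfolding tri[symmetric] w co_simps .
      qed
    qed
    then have "0 = trace (\<lambda>x. D (\<delta> x))" using orth by simp
    also have "\<dots> = (\<Sum>i<d. co i (D (\<delta> (e i))))"
      unfolding trace_def reindex co_def ..
    also have "\<dots> = (\<Sum>i<d. \<Sum>m<d. M i m * Y m i)"
      by (simp add: co_D co_\<delta> co_e if_distrib[of "\<lambda>z. _ * z"] cong: if_cong)
    finally show ?thesis by simp
  qed
  let ?M = "\<lambda>i j. to_ac (M i j)"
  let ?D = "\<lambda>u k. \<Sum>m<d. ?M k m * u m"
  have nil: "(?D ^^ d) u a = 0" if "a < d" for u a
  proof (rule derivation_matrix_nilpotent[OF _ _ that])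
    show "derivation_matrix d (\<lambda>i j k. to_ac (c i j k)) ?M"
      using M unfolding derivation_matrix_def
      by (simp flip: to_ac_mult to_ac_sum to_ac_add)
    fix Y assume Y: "derivation_matrix d (\<lambda>i j k. to_ac (c i j k)) Y"
    interpret K: vector_space "\<lambda>(q::'k) z. to_ac q * z"
      by unfold_locales (simp_all add: algebra_simps)
    show "(\<Sum>i<d. \<Sum>m<d. ?M i m * Y m i) = 0"
    proof (rule ccontr)
      assume nz: "(\<Sum>i<d. \<Sum>m<d. ?M i m * Y m i) \<noteq> 0"
      obtain l where l: "Vector_Spaces.linear (\<lambda>(q::'k) z. to_ac q * z) (*) l"
        and l1: "l (\<Sum>i<d. \<Sum>m<d. ?M i m * Y m i) = 1"
        using K.ex_linear_functional[of "{0}"] nz K.subspace_single_0 by blast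
      interpret l: Vector_Spaces.linear "\<lambda>(q::'k) z. to_ac q * z" "(*)" l by (rule l)
      have l2: "l (z * to_ac q) = q * l z" for q z
        using l.scale[of q z] by (simp add: mult.commute)
      have "derivation_matrix d c (\<lambda>i j. l (Y i j))"
        unfolding derivation_matrix_def
      proof (intro allI impI)
        fix i j k assume "i < d" "j < d" "k < d"
        then have "l (\<Sum>m<d. Y k m * to_ac (c i j m)) =
            l ((\<Sum>m<d. Y m i * to_ac (c m j k)) + (\<Sum>m<d. Y m j * to_ac (c i m k)))"
          using Y by (simp add: derivation_matrix_def)
        then show "(\<Sum>m<d. l (Y k m) * c i j m) = (\<Sum>m<d. l (Y m i) * c m j k) + (\<Sum>m<d. l (Y m j) * c i m k)"
          by (simp add: l.add l.sum l2 mult.commute)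
      qed
      from trace_0[OF this] l1 show False by (simp add: l.sum l.scale)
    qed
  qed
  have "to_ac (co a ((D ^^ n) v)) = (?D ^^ n) (\<lambda>i. to_ac (co i v)) a" for n a v
    by (induction n arbitrary: a) (simp_all add: co_D to_ac_sum)
  then have "to_ac (co a ((D ^^ d) v)) = 0" if "a < d" for a v
    by (simp only: nil[OF that])
  then have "co a ((D ^^ d) v) = co a 0" if "a < d" for a v
    using that by (simp add: co_def representation_zero)
  then have "(D ^^ d) v = 0" for v
    by (rule eqI)
  then show ?thesis by blast
qed

end

section \<open>Engel's theorem for Leibniz algebras\<close>

context leibniz_algebra begin

lemma bracket_diff: "\<lbrakk>x - x', y\<rbrakk> = \<lbrakk>x, y\<rbrakk> - \<lbrakk>x', y\<rbrakk>" "\<lbrakk>x, y - y'\<rbrakk> = \<lbrakk>x, y\<rbrakk> - \<lbrakk>x, y'\<rbrakk>"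
  using bracket_simps(1)[of "x - x'" x' y] bracket_simps(2)[of x "y - y'" y'] by (simp_all add: algebra_simps)

lemma subspace_leib_kernel: "subspace leib_kernel"
  by (simp add: leib_kernel_def)

lemma bracket_leib_kernel: "x \<in> leib_kernel \<Longrightarrow> \<lbrakk>x, y\<rbrakk> \<in> leib_kernel"
  using ideal_leib_kernel by (simp add: ideal_def)

lemma bracket_leib_kernel_right: "x \<in> leib_kernel \<Longrightarrow> \<lbrakk>y, x\<rbrakk> = 0"
  unfolding leib_kernel_def
proof (induction rule: span_induct)
  case base
  show ?case by (auto simp: subspace_def bracket_simps)
next
  case (step x)
  then obtain z where x: "x = \<lbrakk>z, z\<rbrakk>" by blast
  show ?case unfolding x using leibniz_identity[of y z z] by (simp only: add_cancel_right_right)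
qed

lemma square_in_leib_kernel: "\<lbrakk>x, x\<rbrakk> \<in> leib_kernel"
  unfolding leib_kernel_def by (rule span_base) blast

lemma symmetrized_bracket_in_leib_kernel: "\<lbrakk>x, y\<rbrakk> + \<lbrakk>y, x\<rbrakk> \<in> leib_kernel"
proof -
  have "\<lbrakk>x, y\<rbrakk> + \<lbrakk>y, x\<rbrakk> = \<lbrakk>x + y, x + y\<rbrakk> - \<lbrakk>x, x\<rbrakk> - \<lbrakk>y, y\<rbrakk>"
    by (simp add: bracket_simps)
  then show ?thesis
    using subspace_diff[OF subspace_leib_kernel] square_in_leib_kernel by presburger
qed

text \<open>The bracket is antisymmetric modulo the Leibniz kernel, so for subspaces containing the kernel
  one-sided absorption is two-sided.\<close>

lemma bracket_swap_mod:
  assumes "subspace K" "leib_kernel \<subseteq> K" "\<lbrakk>x, y\<rbrakk> \<in> K"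
  shows "\<lbrakk>y, x\<rbrakk> \<in> K"
  using subspace_diff[OF assms(1) subsetD[OF assms(2) symmetrized_bracket_in_leib_kernel[of x y]] assms(3)]
  by simp

lemma subspace_bracket_sets: "subspace (bracket_sets A B)"
  by (simp add: bracket_sets_def)

lemma bracket_in_bracket_sets: "x \<in> A \<Longrightarrow> y \<in> B \<Longrightarrow> \<lbrakk>x, y\<rbrakk> \<in> bracket_sets A B"
  unfolding bracket_sets_def by (rule span_base) blast

lemma bracket_sets_minimal:
  "subspace C \<Longrightarrow> (\<And>x y. x \<in> A \<Longrightarrow> y \<in> B \<Longrightarrow> \<lbrakk>x, y\<rbrakk> \<in> C) \<Longrightarrow> bracket_sets A B \<subseteq> C"
  unfolding bracket_sets_def by (intro span_minimal) auto

lemma solvable_of_derived: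
  assumes "subspace K" "bracket_sets K K \<subseteq> M" "solvable M"
  shows "solvable K"
proof -
  obtain m where m: "derived_series M m = {0}" using assms(3) by (auto simp: solvable_def)
  have "derived_series K (1 + m) = derived_series (bracket_sets K K) m"
    unfolding derived_series_add by simp
  also have "\<dots> \<subseteq> {0}" using derived_series_subset[OF assms(2)] m by metis
  finally have "derived_series K (1 + m) = {0}"
    using subspace_0[OF subspace_derived_series[OF assms(1)]] by blast
  then show ?thesis unfolding solvable_def by blast
qed

lemma solvable_leib_kernel: "solvable leib_kernel"
proof -
  have "bracket_sets leib_kernel leib_kernel \<subseteq> {0}"
    by (rule bracket_sets_minimal) (simp_all add: bracket_leib_kernel_right)
  moreover have "solvable {0}" unfolding solvable_def by (rule exI[of _ 0]) simp
  ultimately show ?thesis by (rule solvable_of_derived[OF subspace_leib_kernel])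
qed

end

locale finite_dim_leibniz_algebra = leibniz_algebra scale bracket + finite_dim_algebra scale Basis bracket
  for scale :: "'k::field_char_0 \<Rightarrow> 'v::ab_group_add \<Rightarrow> 'v" (infixr "*s" 75)
    and bracket :: "'v \<Rightarrow> 'v \<Rightarrow> 'v" ("\<lbrakk>_,/ _\<rbrakk>") and Basis
begin

lemma dim_less_of_psubset: "subspace S \<Longrightarrow> subspace T \<Longrightarrow> S \<subset> T \<Longrightarrow> dim S < dim T"
  by (metis dim_psubset span_eq_iff)

lemma ex_maximal_dim:
  assumes "P (A::'v set)"
  shows "\<exists>S. P S \<and> (\<forall>T. P T \<longrightarrow> dim T \<le> dim S)"
  using ex_has_greatest_nat[of P A dim "Suc dimension"] assms dim_subset_UNIV le_imp_less_Suc by blast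

text \<open>Engel's theorem for right multiplications, in the relative form that lets the induction run
  through subquotients \<open>S / T\<close>. A subalgebra \<open>K\<close> of maximal dimension for which the conclusion holds
  must be \<open>M\<close>: otherwise the conclusion for the module \<open>M / K\<close> itself yields \<open>v \<notin> K\<close> normalizing
  \<open>K\<close>, and nilpotency of the multiplication by \<open>v\<close> extends the conclusion to \<open>K + kv\<close>. The
  subalgebras are required to contain the Leibniz kernel so that normalizing on one side suffices.\<close>

theorem engel:
  assumes M: "subspace M" "\<And>x y. x \<in> M \<Longrightarrow> y \<in> M \<Longrightarrow> \<lbrakk>x, y\<rbrakk> \<in> M" "leib_kernel \<subseteq> M"
    and nil: "\<And>x. x \<in> M \<Longrightarrow> \<exists>n. \<forall>z. ((\<lambda>z. \<lbrakk>z, x\<rbrakk>) ^^ n) z = 0"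
    and S: "subspace S" "\<And>x y. x \<in> S \<Longrightarrow> y \<in> M \<Longrightarrow> \<lbrakk>x, y\<rbrakk> \<in> S"
    and T: "subspace T" "\<And>x y. x \<in> T \<Longrightarrow> y \<in> M \<Longrightarrow> \<lbrakk>x, y\<rbrakk> \<in> T" "T \<subset> S"
  obtains v where "v \<in> S" "v \<notin> T" "\<And>y. y \<in> M \<Longrightarrow> \<lbrakk>v, y\<rbrakk> \<in> T"
proof -
  define engel_property where "engel_property K \<longleftrightarrow> (\<forall>S T. subspace S \<and> (\<forall>x\<in>S. \<forall>y\<in>K. \<lbrakk>x, y\<rbrakk> \<in> S) \<and>
    subspace T \<and> (\<forall>x\<in>T. \<forall>y\<in>K. \<lbrakk>x, y\<rbrakk> \<in> T) \<and> T \<subset> S \<longrightarrow> (\<exists>v\<in>S - T. \<forall>y\<in>K. \<lbrakk>v, y\<rbrakk> \<in> T))" for K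
  define good where "good K \<longleftrightarrow> subspace K \<and> (\<forall>x\<in>K. \<forall>y\<in>K. \<lbrakk>x, y\<rbrakk> \<in> K) \<and> leib_kernel \<subseteq> K \<and> K \<subseteq> M \<and>
    engel_property K" for K
  have engelD: "\<exists>v\<in>S - T. \<forall>y\<in>K. \<lbrakk>v, y\<rbrakk> \<in> T"
    if "engel_property K" "subspace S" "\<forall>x\<in>S. \<forall>y\<in>K. \<lbrakk>x, y\<rbrakk> \<in> S"
      "subspace T" "\<forall>x\<in>T. \<forall>y\<in>K. \<lbrakk>x, y\<rbrakk> \<in> T" "T \<subset> S" for K S T
    using that(1)[unfolded engel_property_def, rule_format, of S T] that(2-) by blast
  have "engel_property leib_kernel"
    unfolding engel_property_def
  proof (intro allI impI, elim conjE)
    fix S T :: "'v set" assume T: "subspace T" and "T \<subset> S"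
    then obtain v where "v \<in> S - T" by blast
    moreover have "\<forall>y\<in>leib_kernel. \<lbrakk>v, y\<rbrakk> \<in> T"
      by (simp add: bracket_leib_kernel_right subspace_0[OF T])
    ultimately show "\<exists>v\<in>S - T. \<forall>y\<in>leib_kernel. \<lbrakk>v, y\<rbrakk> \<in> T" by blast
  qed
  then have "good leib_kernel"
    unfolding good_def using M(3) subspace_leib_kernel bracket_leib_kernel by blast
  then obtain K where K: "good K" and max: "\<And>K'. good K' \<Longrightarrow> dim K' \<le> dim K"
    using ex_maximal_dim[of good] by blast
  note K' = K[unfolded good_def]
  have "K = M"
  proof (rule ccontr)
    assume "K \<noteq> M"
    then have "K \<subset> M" using K' by blast
    moreover have "\<forall>x\<in>M. \<forall>y\<in>K. \<lbrakk>x, y\<rbrakk> \<in> M" using M(2) K' by blast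
    ultimately have "\<exists>v\<in>M - K. \<forall>y\<in>K. \<lbrakk>v, y\<rbrakk> \<in> K"
      using engelD[of K M K] K' M(1) by simp
    then obtain v where v: "v \<in> M" "v \<notin> K" "\<And>y. y \<in> K \<Longrightarrow> \<lbrakk>v, y\<rbrakk> \<in> K" by blast
    have vr: "\<lbrakk>y, v\<rbrakk> \<in> K" if "y \<in> K" for y
      using bracket_swap_mod[OF _ _ v(3)[OF that]] K' by blast
    let ?K = "span (insert v K)"
    have K_span: "span K = K" using K' span_eq_iff by blast
    have mem: "\<exists>c k. k \<in> K \<and> x = k + c *s v" if x: "x \<in> ?K" for x
    proof -
      obtain c where "x - c *s v \<in> K" using x unfolding span_insert K_span by blast
      then show ?thesis by (intro exI[of _ c] exI[of _ "x - c *s v"]) simp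
    qed
    have br: "\<lbrakk>x, y\<rbrakk> \<in> K" if x: "x \<in> ?K" and y: "y \<in> ?K" for x y
    proof -
      obtain c k where x: "k \<in> K" "x = k + c *s v" using mem[OF x] by blast
      obtain c' k' where y: "k' \<in> K" "y = k' + c' *s v" using mem[OF y] by blast
      have "\<lbrakk>v, v\<rbrakk> \<in> K" using square_in_leib_kernel K' by blast
      moreover have "\<lbrakk>k, k'\<rbrakk> \<in> K" "\<lbrakk>k, v\<rbrakk> \<in> K" "\<lbrakk>v, k'\<rbrakk> \<in> K"
        using x(1) y(1) v(3) vr K' by simp_all
      moreover have "subspace K" using K' by simp
      ultimately show ?thesis
        unfolding x(2) y(2) bracket_simps by (simp add: subspace_add subspace_scale)
    qed
    have KK: "K \<subseteq> ?K" by (meson span_superset subset_insertI subset_trans)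
    have vK: "v \<in> ?K" by (rule span_base) simp
    have "good ?K"
      unfolding good_def
    proof (intro conjI ballI)
      show "subspace ?K" by simp
      show "leib_kernel \<subseteq> ?K" using KK K' by blast
      show "?K \<subseteq> M" using M(1) v(1) K' by (intro span_minimal) auto
      show "\<lbrakk>x, y\<rbrakk> \<in> ?K" if "x \<in> ?K" "y \<in> ?K" for x y using br[OF that] KK by blast
      show "engel_property ?K"
        unfolding engel_property_def
      proof (intro allI impI, elim conjE)
        fix S T assume S: "subspace S" "\<forall>x\<in>S. \<forall>y\<in>?K. \<lbrakk>x, y\<rbrakk> \<in> S"
          and T: "subspace T" "\<forall>x\<in>T. \<forall>y\<in>?K. \<lbrakk>x, y\<rbrakk> \<in> T" and TS: "T \<subset> S"
        \<comment> \<open>The vectors annihilated by \<open>K\<close> modulo \<open>T\<close> are stable under \<open>v\<close>; the last vector outside \<open>T\<close> on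
          the orbit of one of them under \<open>v\<close> is annihilated by \<open>v\<close> as well.\<close>
        define W where "W = {w \<in> S. \<forall>y\<in>K. \<lbrakk>w, y\<rbrakk> \<in> T}"
        have "\<exists>w\<in>S - T. \<forall>y\<in>K. \<lbrakk>w, y\<rbrakk> \<in> T"
        proof (rule engelD)
          show "\<forall>x\<in>S. \<forall>y\<in>K. \<lbrakk>x, y\<rbrakk> \<in> S" "\<forall>x\<in>T. \<forall>y\<in>K. \<lbrakk>x, y\<rbrakk> \<in> T"
            using S(2) T(2) KK by blast+
        qed (use K' S(1) T(1) TS in simp_all)
        then obtain w where w: "w \<in> W" "w \<notin> T" by (auto simp: W_def)
        have W: "\<lbrakk>w, v\<rbrakk> \<in> W" if "w \<in> W" for w
        proof -
          have "\<lbrakk>\<lbrakk>w, v\<rbrakk>, y\<rbrakk> \<in> T" if "y \<in> K" for y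
          proof -
            have "\<lbrakk>w, y\<rbrakk> \<in> T" "\<lbrakk>w, \<lbrakk>v, y\<rbrakk>\<rbrakk> \<in> T" using \<open>w \<in> W\<close> that v(3) by (simp_all add: W_def)
            moreover have "\<lbrakk>\<lbrakk>w, y\<rbrakk>, v\<rbrakk> \<in> T" using T(2) vK calculation(1) by blast
            ultimately show ?thesis
              unfolding leibniz_identity[of w v y] by (simp add: subspace_add[OF T(1)])
          qed
          then show ?thesis using \<open>w \<in> W\<close> S(2) vK by (auto simp: W_def)
        qed
        have last: "\<exists>u\<in>W. u \<notin> T \<and> \<lbrakk>u, v\<rbrakk> \<in> T"
          if "w \<in> W" "w \<notin> T" "((\<lambda>z. \<lbrakk>z, v\<rbrakk>) ^^ n) w \<in> T" for n w
          using that
        proof (induction n arbitrary: w)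
          case (Suc n)
          have "((\<lambda>z. \<lbrakk>z, v\<rbrakk>) ^^ n) \<lbrakk>w, v\<rbrakk> \<in> T"
            using Suc.prems(3) by (simp only: funpow_Suc_right o_apply)
          then show ?case
            using Suc.prems(1,2) W[OF Suc.prems(1)] Suc.IH[of "\<lbrakk>w, v\<rbrakk>"] by (cases "\<lbrakk>w, v\<rbrakk> \<in> T") blast+
        qed simp
        obtain n where "((\<lambda>z. \<lbrakk>z, v\<rbrakk>) ^^ n) w = 0" using nil[OF v(1)] by blast
        then have "((\<lambda>z. \<lbrakk>z, v\<rbrakk>) ^^ n) w \<in> T" using subspace_0[OF T(1)] by (simp only:)
        then obtain u where u: "u \<in> W" "u \<notin> T" "\<lbrakk>u, v\<rbrakk> \<in> T" using last[OF w] by blast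
        have "\<lbrakk>u, y\<rbrakk> \<in> T" if y: "y \<in> ?K" for y
        proof -
          obtain c k where y: "k \<in> K" "y = k + c *s v" using mem[OF y] by blast
          have "\<lbrakk>u, k\<rbrakk> \<in> T" using u(1) y(1) by (simp add: W_def)
          then show ?thesis unfolding y(2) bracket_simps
            by (intro subspace_add[OF T(1)] subspace_scale[OF T(1)] u(3))
        qed
        then show "\<exists>v\<in>S - T. \<forall>y\<in>?K. \<lbrakk>v, y\<rbrakk> \<in> T" using u by (auto simp: W_def)
      qed
    qed
    then have "dim ?K \<le> dim K" by (rule max)
    moreover have "dim K < dim ?K"
      using KK vK v(2) K' by (intro dim_less_of_psubset) auto
    ultimately show False by simp
  qed
  then have "engel_property M" using K' by simp
  then have "\<exists>v\<in>S - T. \<forall>y\<in>M. \<lbrakk>v, y\<rbrakk> \<in> T"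
    by (rule engelD) (use S T in auto)
  then show ?thesis using that by blast
qed

text \<open>The lower central series \<open>C\<close> bounds the derived series, and it decreases strictly: if \<open>T\<close> is a
  maximal proper stable subspace of \<open>C j\<close>, Engel's theorem shows that \<open>M\<close> acts as zero on
  \<open>C j / T\<close>, whence \<open>[C j, M] \<subseteq> T\<close>.\<close>

lemma engel_solvable:
  assumes M: "subspace M" "\<And>x y. x \<in> M \<Longrightarrow> y \<in> M \<Longrightarrow> \<lbrakk>x, y\<rbrakk> \<in> M" "leib_kernel \<subseteq> M"
    and nil: "\<And>x. x \<in> M \<Longrightarrow> \<exists>n. \<forall>z. ((\<lambda>z. \<lbrakk>z, x\<rbrakk>) ^^ n) z = 0"
  shows "solvable M"
proof -
  define C where "C j = ((\<lambda>S. bracket_sets S M) ^^ j) M" for j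
  have C_Suc: "C (Suc j) = bracket_sets (C j) M" for j by (simp add: C_def)
  have C: "subspace (C j) \<and> C j \<subseteq> M \<and> (\<forall>x\<in>C j. \<forall>y\<in>M. \<lbrakk>x, y\<rbrakk> \<in> C j)" for j
  proof (induction j)
    case (Suc j)
    then have "C (Suc j) \<subseteq> C j"
      unfolding C_Suc by (intro bracket_sets_minimal) auto
    then show ?case
      using Suc subspace_bracket_sets[of "C j" M] bracket_in_bracket_sets[of _ "C j" _ M]
      unfolding C_Suc by blast
  qed (use M in \<open>simp add: C_def\<close>)
  have sub: "derived_series M j \<subseteq> C j" for j
  proof (induction j)
    case (Suc j)
    then show ?case
      unfolding C_Suc derived_series.simps bracket_sets_def using C[of j] by (intro span_mono) blast
  qed (simp add: C_def)
  have strict: "C (Suc j) \<subset> C j" if "C j \<noteq> {0}" for j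
  proof -
    define stable where "stable T \<longleftrightarrow> subspace T \<and> (\<forall>x\<in>T. \<forall>y\<in>M. \<lbrakk>x, y\<rbrakk> \<in> T) \<and> T \<subset> C j" for T
    have "stable {0}"
      using that C[of j] subspace_0[of "C j"] by (auto simp: stable_def bracket_simps)
    then obtain T where T: "stable T" and max: "\<And>T'. stable T' \<Longrightarrow> dim T' \<le> dim T"
      using ex_maximal_dim[of stable] by blast
    note T' = T[unfolded stable_def]
    have Cj: "subspace (C j)" "\<And>x y. x \<in> C j \<Longrightarrow> y \<in> M \<Longrightarrow> \<lbrakk>x, y\<rbrakk> \<in> C j" using C[of j] by blast+
    have Tst: "subspace T" "\<And>x y. x \<in> T \<Longrightarrow> y \<in> M \<Longrightarrow> \<lbrakk>x, y\<rbrakk> \<in> T" "T \<subset> C j" using T' by blast+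
    obtain v where v: "v \<in> C j" "v \<notin> T" "\<And>y. y \<in> M \<Longrightarrow> \<lbrakk>v, y\<rbrakk> \<in> T"
      by (rule engel[OF M nil Cj Tst]) (assumption | (rule that; assumption))+
    let ?T = "span (insert v T)"
    have T_span: "span T = T" using T' span_eq_iff by blast
    have br: "\<lbrakk>x, y\<rbrakk> \<in> T" if x: "x \<in> ?T" and y: "y \<in> M" for x y
    proof -
      obtain c where c: "x - c *s v \<in> T" using x unfolding span_insert T_span by blast
      have "\<lbrakk>x, y\<rbrakk> = \<lbrakk>x - c *s v, y\<rbrakk> + c *s \<lbrakk>v, y\<rbrakk>" by (simp add: bracket_diff bracket_simps)
      then show ?thesis using Tst(2)[OF c y] v(3)[OF y] by (simp add: subspace_add[OF Tst(1)] subspace_scale[OF Tst(1)])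
    qed
    have TT: "T \<subseteq> ?T" by (meson span_superset subset_insertI subset_trans)
    have vT: "v \<in> ?T" by (rule span_base) simp
    have "?T \<subseteq> C j" using v(1) T' C[of j] by (intro span_minimal) auto
    moreover have "\<not> stable ?T"
    proof
      assume "stable ?T"
      then have "dim ?T \<le> dim T" by (rule max)
      moreover have "T \<subset> ?T" using TT vT v(2) by blast
      then have "dim T < dim ?T" by (rule dim_less_of_psubset[rotated 2]) (simp_all add: T')
      ultimately show False by simp
    qed
    moreover have "\<forall>x\<in>?T. \<forall>y\<in>M. \<lbrakk>x, y\<rbrakk> \<in> ?T" using br TT by blast
    ultimately have "?T = C j" unfolding stable_def by auto
    then have "C (Suc j) \<subseteq> T"
      unfolding C_Suc using br T' by (intro bracket_sets_minimal) auto
    then show ?thesis using T' by blast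
  qed
  obtain j where j: "\<And>i. dim (C j) \<le> dim (C i)"
    using ex_has_least_nat[of "\<lambda>_. True" 0 "\<lambda>j. dim (C j)"] by blast
  have "C j = {0}"
  proof (rule ccontr)
    assume "C j \<noteq> {0}"
    have "dim (C (Suc j)) < dim (C j)"
      by (rule dim_less_of_psubset[OF _ _ strict[OF \<open>C j \<noteq> {0}\<close>]]) (simp_all add: C)
    with j[of "Suc j"] show False by simp
  qed
  then have "derived_series M j = {0}"
    using sub[of j] subspace_0[OF subspace_derived_series[OF M(1), of j]] by blast
  then show ?thesis unfolding solvable_def by blast
qed

end

section \<open>The Killing form and perfectness\<close>

text \<open>This replaces a dimension count when the Killing form is used to represent functionals. Induction
  on \<open>A\<close>: if \<open>g a\<close> does not vanish on the common kernel of the other functionals, a multiple of it is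
  subtracted from \<open>f\<close> so that the difference vanishes there.\<close>

lemma (in vector_space) functional_in_span:
  assumes "finite A" "Vector_Spaces.linear scale (*) f" "\<And>a. a \<in> A \<Longrightarrow> Vector_Spaces.linear scale (*) (g a)"
    and "\<And>w. (\<And>a. a \<in> A \<Longrightarrow> g a w = 0) \<Longrightarrow> f w = 0"
  shows "\<exists>c. \<forall>w. f w = (\<Sum>a\<in>A. c a * g a w)"
  using assms
proof (induction A arbitrary: f)
  case (insert a A f)
  interpret f: Vector_Spaces.linear scale "(*)" f by (rule insert.prems)
  interpret ga: Vector_Spaces.linear scale "(*)" "g a" by (rule insert.prems) simp
  have g: "Vector_Spaces.linear scale (*) (g b)" if "b \<in> A" for b using insert.prems(2) that by simp
  show ?case
  proof (cases "\<exists>v. (\<forall>b\<in>A. g b v = 0) \<and> g a v \<noteq> 0")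
    case False
    have "\<exists>c. \<forall>w. f w = (\<Sum>b\<in>A. c b * g b w)"
    proof (rule insert.IH[OF insert.prems(1) g])
      fix w assume w: "\<And>b. b \<in> A \<Longrightarrow> g b w = 0"
      then have "g a w = 0" using False by blast
      then show "f w = 0" using w by (intro insert.prems(3)) blast
    qed
    then obtain c where c: "\<And>w. f w = (\<Sum>b\<in>A. c b * g b w)" by blast
    have "f w = (\<Sum>b\<in>insert a A. (c(a := 0)) b * g b w)" for w
    proof -
      have "(\<Sum>b\<in>A. (c(a := 0)) b * g b w) = (\<Sum>b\<in>A. c b * g b w)"
        by (intro sum.cong refl) (use insert.hyps in auto)
      then show ?thesis using insert.hyps by (simp add: c)
    qed
    then show ?thesis by blast
  next
    case True
    then obtain v where v: "\<And>b. b \<in> A \<Longrightarrow> g b v = 0" "g a v \<noteq> 0" by blast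
    define s where "s = f v / g a v"
    have lin: "Vector_Spaces.linear scale (*) (\<lambda>w. f w - s * g a w)"
      unfolding Vector_Spaces.linear_iff
    proof (intro conjI allI)
      fix x y r
      show "f (x + y) - s * g a (x + y) = f x - s * g a x + (f y - s * g a y)"
        unfolding f.add ga.add distrib_left by simp
      show "f (scale r x) - s * g a (scale r x) = r * (f x - s * g a x)"
        unfolding f.scale ga.scale right_diff_distrib by (simp only: mult.left_commute)
    qed (fact Vector_Spaces.linear.axioms(1,2)[OF insert.prems(1)])+
    have "\<exists>c. \<forall>w. f w - s * g a w = (\<Sum>b\<in>A. c b * g b w)"
    proof (rule insert.IH[OF lin g])
      fix w assume w: "\<And>b. b \<in> A \<Longrightarrow> g b w = 0"
      let ?u = "w - scale (g a w / g a v) v"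
      have "g b ?u = 0" if "b \<in> insert a A" for b
      proof (cases "b = a")
        case True
        then show ?thesis using v(2) by (simp add: ga.diff ga.scale)
      next
        case False
        then have b: "b \<in> A" using that by simp
        interpret gb: Vector_Spaces.linear scale "(*)" "g b" by (rule g[OF b])
        show ?thesis using w[OF b] v(1)[OF b] by (simp add: gb.diff gb.scale)
      qed
      then have "f ?u = 0" by (rule insert.prems(3))
      then have "f w = g a w / g a v * f v" by (simp only: f.diff f.scale right_minus_eq)
      then show "f w - s * g a w = 0" by (simp only: s_def right_minus_eq times_divide_eq_left times_divide_eq_right mult.commute)
    qed
    then obtain c where c: "\<And>w. f w - s * g a w = (\<Sum>b\<in>A. c b * g b w)" by blast
    have "f w = (\<Sum>b\<in>insert a A. (c(a := s)) b * g b w)" for w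
    proof -
      have "(\<Sum>b\<in>A. (c(a := s)) b * g b w) = (\<Sum>b\<in>A. c b * g b w)"
        by (intro sum.cong refl) (use insert.hyps in auto)
      then show ?thesis using insert.hyps c[of w, symmetric] by simp
    qed
    then show ?thesis by blast
  qed
qed simp

context finite_dim_leibniz_algebra begin

definition killing_form :: "'v \<Rightarrow> 'v \<Rightarrow> 'k" where
  "killing_form x y = trace (\<lambda>z. \<lbrakk>\<lbrakk>z, x\<rbrakk>, y\<rbrakk>)"

definition killing_radical :: "'v set" where
  "killing_radical = {x. \<forall>y. killing_form x y = 0}"

lemma derivation_right_mult: "derivation (\<lambda>z. \<lbrakk>z, x\<rbrakk>)"
  unfolding derivation_def using linear_bracket_left leibniz_identity by blast

lemma killing_form_commute: "killing_form x y = killing_form y x"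
  unfolding killing_form_def by (rule trace_comp_commute) (rule linear_bracket_left)+

lemma linear_trace_right_mult: "Vector_Spaces.linear (*s) (*) (\<lambda>x. trace (\<lambda>z. \<lbrakk>g z, x\<rbrakk>))"
  unfolding Vector_Spaces.linear_iff
  using Vector_Spaces.linear.axioms(2)[OF linear_coordinate]
  by (simp add: vector_space_axioms trace_def bracket_simps coordinate_simps sum.distrib sum_distrib_left)

lemma linear_killing_form: "Vector_Spaces.linear (*s) (*) (killing_form x)"
  unfolding killing_form_def[abs_def] by (rule linear_trace_right_mult)

text \<open>From \<open>R\<^bsub>[a,b]\<^esub> = R\<^sub>b R\<^sub>a - R\<^sub>a R\<^sub>b\<close> and cyclicity of the trace, \<open>tr(R\<^bsub>[a,b]\<^esub> \<delta>)\<close> is the trace of \<open>R\<^sub>a\<close>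
  times the commutator of \<open>\<delta>\<close> and \<open>R\<^sub>b\<close>, which is the right multiplication by \<open>\<delta> b\<close>. For \<open>\<delta>\<close> a right
  multiplication this is invariance of the Killing form.\<close>

lemma trace_bracket_derivation:
  assumes \<delta>: "derivation \<delta>"
  shows "trace (\<lambda>z. \<lbrakk>\<delta> z, \<lbrakk>a, b\<rbrakk>\<rbrakk>) = killing_form (\<delta> b) a"
proof -
  interpret \<delta>: Vector_Spaces.linear "(*s)" "(*s)" \<delta> using \<delta> by (simp add: derivation_def)
  have lin: "Vector_Spaces.linear (*s) (*s) (\<lambda>z. \<lbrakk>\<delta> z, a\<rbrakk>)"
    using Vector_Spaces.linear_compose[OF _ linear_bracket_left[of a], of "(*s)" \<delta>] \<delta>
    by (simp add: derivation_def o_def)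
  have der: "\<delta> \<lbrakk>z, b\<rbrakk> = \<lbrakk>\<delta> z, b\<rbrakk> + \<lbrakk>z, \<delta> b\<rbrakk>" for z using \<delta> by (simp add: derivation_def)
  have "\<lbrakk>\<delta> z, \<lbrakk>a, b\<rbrakk>\<rbrakk> = \<lbrakk>\<lbrakk>\<delta> z, a\<rbrakk>, b\<rbrakk> - \<lbrakk>\<lbrakk>\<delta> z, b\<rbrakk>, a\<rbrakk>" for z
    using leibniz_identity[of "\<delta> z" a b] by simp
  then have "trace (\<lambda>z. \<lbrakk>\<delta> z, \<lbrakk>a, b\<rbrakk>\<rbrakk>) = trace (\<lambda>z. \<lbrakk>\<lbrakk>\<delta> z, a\<rbrakk>, b\<rbrakk>) - trace (\<lambda>z. \<lbrakk>\<lbrakk>\<delta> z, b\<rbrakk>, a\<rbrakk>)"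
    by (simp add: trace_linear_combination(1))
  also have "trace (\<lambda>z. \<lbrakk>\<lbrakk>\<delta> z, a\<rbrakk>, b\<rbrakk>) = trace (\<lambda>z. \<lbrakk>\<delta> \<lbrakk>z, b\<rbrakk>, a\<rbrakk>)"
    by (rule trace_comp_commute[OF linear_bracket_left lin])
  also have "\<dots> - trace (\<lambda>z. \<lbrakk>\<lbrakk>\<delta> z, b\<rbrakk>, a\<rbrakk>) = trace (\<lambda>z. \<lbrakk>\<delta> \<lbrakk>z, b\<rbrakk>, a\<rbrakk> - \<lbrakk>\<lbrakk>\<delta> z, b\<rbrakk>, a\<rbrakk>)"
    by (simp add: trace_linear_combination(1))
  also have "\<dots> = killing_form (\<delta> b) a"
    by (simp add: killing_form_def der bracket_simps)
  finally show ?thesis .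
qed

lemma killing_form_invariant: "killing_form c \<lbrakk>a, b\<rbrakk> = killing_form \<lbrakk>b, c\<rbrakk> a"
  unfolding killing_form_def[of c] by (rule trace_bracket_derivation[OF derivation_right_mult])

lemma leib_kernel_subset_killing_radical: "leib_kernel \<subseteq> killing_radical"
proof
  fix x assume x: "x \<in> leib_kernel"
  have "killing_form y x = 0" for y
    by (simp add: killing_form_def bracket_leib_kernel_right[OF x] trace_def representation_zero)
  then show "x \<in> killing_radical" by (simp add: killing_radical_def killing_form_commute[of x])
qed

lemma subspace_killing_radical: "subspace killing_radical"
proof -
  have *: "killing_radical = {x. \<forall>y. killing_form y x = 0}"
    by (simp add: killing_radical_def killing_form_commute)
  interpret k: Vector_Spaces.linear "(*s)" "(*)" "killing_form y" for y by (rule linear_killing_form)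
  show ?thesis unfolding * by (auto simp: subspace_def k.add k.scale k.zero)
qed

lemma ideal_killing_radical: "ideal killing_radical"
  unfolding ideal_def
proof (intro conjI ballI allI)
  fix x y assume x: "x \<in> killing_radical"
  have "killing_form \<lbrakk>x, y\<rbrakk> z = 0" for z
  proof -
    have "killing_form \<lbrakk>x, y\<rbrakk> z = killing_form z \<lbrakk>x, y\<rbrakk>" by (rule killing_form_commute)
    also have "\<dots> = killing_form \<lbrakk>y, z\<rbrakk> x" by (rule killing_form_invariant)
    also have "\<dots> = killing_form x \<lbrakk>y, z\<rbrakk>" by (rule killing_form_commute)
    finally show ?thesis using x by (simp add: killing_radical_def)
  qed
  then show xy: "\<lbrakk>x, y\<rbrakk> \<in> killing_radical" by (simp add: killing_radical_def)
  show "\<lbrakk>y, x\<rbrakk> \<in> killing_radical"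
    by (rule bracket_swap_mod[OF subspace_killing_radical leib_kernel_subset_killing_radical xy])
qed (rule subspace_killing_radical)

text \<open>Cartan's criterion: elements of \<open>[R, R]\<close> act by derivations that are trace-orthogonal to all
  derivations and hence nilpotent. Adding the Leibniz kernel, whose elements act as zero from the
  right, meets the requirement of Engel's theorem.\<close>

theorem solvable_killing_radical: "solvable killing_radical"
proof -
  let ?R = killing_radical
  define M where "M = span ({\<lbrakk>a, b\<rbrakk> | a b. a \<in> ?R \<and> b \<in> ?R} \<union> leib_kernel)"
  have gen: "\<lbrakk>a, b\<rbrakk> \<in> M" if "a \<in> ?R" "b \<in> ?R" for a b
    unfolding M_def by (rule span_base) (use that in blast)
  have MR: "M \<subseteq> ?R"
    unfolding M_def using ideal_killing_radical leib_kernel_subset_killing_radical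
    by (intro span_minimal) (auto simp: ideal_def)
  have nil: "\<exists>n. \<forall>z. ((\<lambda>z. \<lbrakk>z, x\<rbrakk>) ^^ n) z = 0" if x: "x \<in> M" for x
  proof (rule derivation_nilpotent[OF derivation_right_mult])
    fix \<delta> assume \<delta>: "derivation \<delta>"
    interpret t: Vector_Spaces.linear "(*s)" "(*)" "\<lambda>x. trace (\<lambda>z. \<lbrakk>\<delta> z, x\<rbrakk>)" by (rule linear_trace_right_mult)
    show "trace (\<lambda>z. \<lbrakk>\<delta> z, x\<rbrakk>) = 0"
      using x unfolding M_def
    proof (induction rule: span_induct)
      case base
      show ?case by (auto simp: subspace_def t.add t.scale t.zero)
    next
      case (step x)
      then consider a b where "x = \<lbrakk>a, b\<rbrakk>" "a \<in> ?R" | "x \<in> leib_kernel" by blast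
      then show ?case
      proof cases
        case 1
        then show ?thesis
          using trace_bracket_derivation[OF \<delta>, of a b] killing_form_commute[of a "\<delta> b"]
          by (simp add: killing_radical_def)
      next
        case 2
        then show ?thesis by (simp add: bracket_leib_kernel_right trace_def representation_zero)
      qed
    qed
  qed
  have "solvable M"
  proof (rule engel_solvable[OF _ _ _ nil])
    show "subspace M" by (simp add: M_def)
    show "leib_kernel \<subseteq> M" unfolding M_def by (auto intro: span_base)
    show "\<lbrakk>x, y\<rbrakk> \<in> M" if "x \<in> M" "y \<in> M" for x y using gen that MR by blast
  qed
  moreover have "bracket_sets ?R ?R \<subseteq> M"
    by (rule bracket_sets_minimal) (simp_all add: M_def gen[unfolded M_def])
  ultimately show ?thesis using solvable_of_derived subspace_killing_radical by blast
qed

text \<open>Modulo the Leibniz kernel the Killing form is nondegenerate, so a nonzero functional killing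
  \<open>[L,L]\<close> is represented by some \<open>y\<close>. Invariance shows that \<open>y\<close> is central modulo the kernel, and
  the elements that are central modulo the kernel form a solvable ideal.\<close>

theorem semisimple_perfect:
  assumes "semisimple"
  shows "bracket_sets UNIV UNIV = UNIV"
proof (rule ccontr)
  let ?I = leib_kernel and ?R = killing_radical and ?D = "bracket_sets UNIV UNIV"
  assume "?D \<noteq> UNIV"
  then obtain x where x: "x \<notin> ?D" by blast
  have rad: "J \<subseteq> ?I" if "ideal J" "solvable J" for J
    using radical_is_greatest(2)[OF finite_Basis span_Basis that] assms by (simp add: semisimple_def)
  have R: "?R \<subseteq> ?I" by (rule rad[OF ideal_killing_radical solvable_killing_radical])
  have ID: "?I \<subseteq> ?D"
    unfolding leib_kernel_def by (intro span_minimal subspace_bracket_sets) (auto intro: bracket_in_bracket_sets)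
  obtain f where f: "Vector_Spaces.linear (*s) (*) f" "f x = 1" "\<And>s. s \<in> ?D \<Longrightarrow> f s = 0"
    by (rule ex_linear_functional[OF subspace_bracket_sets x]) (rule that; assumption)
  have "\<exists>c. \<forall>w. f w = (\<Sum>b\<in>Basis. c b * killing_form b w)"
  proof (rule functional_in_span[OF finite_Basis f(1) linear_killing_form])
    fix w assume w: "\<And>b. b \<in> Basis \<Longrightarrow> killing_form b w = 0"
    interpret k: Vector_Spaces.linear "(*s)" "(*)" "killing_form w" by (rule linear_killing_form)
    have "killing_form w y = 0" for y
    proof -
      have "killing_form w y = (\<Sum>b\<in>Basis. representation Basis y b * killing_form w b)"
        by (subst coordinate_expand[of y, symmetric]) (simp only: k.sum k.scale)
      also have "\<dots> = 0" using w killing_form_commute[of w] by (simp add: sum.neutral)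
      finally show ?thesis .
    qed
    then have "w \<in> ?R" by (simp add: killing_radical_def)
    then show "f w = 0" using R ID f(3) by blast
  qed
  then obtain c where c: "\<And>w. f w = (\<Sum>b\<in>Basis. c b * killing_form b w)" by blast
  define y where "y = (\<Sum>b\<in>Basis. c b *s b)"
  have f_y: "f w = killing_form y w" for w
  proof -
    interpret k: Vector_Spaces.linear "(*s)" "(*)" "killing_form w" by (rule linear_killing_form)
    have "killing_form w y = (\<Sum>b\<in>Basis. c b * killing_form w b)"
      unfolding y_def by (simp only: k.sum k.scale)
    then show ?thesis by (simp add: c killing_form_commute[of _ w])
  qed
  define Z where "Z = {z. \<forall>b. \<lbrakk>b, z\<rbrakk> \<in> ?I}"
  have IZ: "?I \<subseteq> Z"
    using bracket_leib_kernel_right subspace_0[OF subspace_leib_kernel] by (auto simp: Z_def)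
  have Z: "\<lbrakk>b, z\<rbrakk> \<in> ?I" "\<lbrakk>z, b\<rbrakk> \<in> ?I" if "z \<in> Z" for z b
    using that bracket_swap_mod[OF subspace_leib_kernel subset_refl, of b z] by (auto simp: Z_def)
  have sZ: "subspace Z"
    unfolding subspace_def
    by (auto simp: Z_def bracket_simps subspace_0 subspace_add subspace_scale subspace_leib_kernel)
  have "ideal Z" unfolding ideal_def using sZ Z IZ by blast
  moreover have "solvable Z"
    by (rule solvable_of_derived[OF sZ bracket_sets_minimal[OF subspace_leib_kernel] solvable_leib_kernel])
      (rule Z)
  ultimately have ZI: "Z \<subseteq> ?I" by (rule rad)
  have "\<lbrakk>b, y\<rbrakk> \<in> ?R" for b
  proof -
    have "killing_form \<lbrakk>b, y\<rbrakk> a = 0" for a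
      using f(3)[OF bracket_in_bracket_sets[of a UNIV b UNIV]] by (simp add: f_y killing_form_invariant)
    then show ?thesis by (simp add: killing_radical_def)
  qed
  then have "y \<in> Z" using R by (auto simp: Z_def)
  then have "y \<in> ?R" using ZI leib_kernel_subset_killing_radical by blast
  then have "f x = 0" by (simp add: f_y killing_radical_def)
  with f(2) show False by simp
qed

end

section \<open>The Leibniz kernel of the n-ary algebra\<close>

lemma (in leibniz_n_algebra) n_ideal_leib_n_kernel: "n_ideal leib_n_kernel"
  unfolding leib_n_kernel_def
proof (rule hull_in)
  fix \<T> assume "Ball \<T> n_ideal"
  then show "n_ideal (\<Inter>\<T>)"
    unfolding n_ideal_def by (auto intro!: subspace_Inter)
qed

lemma (in leibniz_n_algebra) repeated_entry_in_leib_n_kernel: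
  assumes "length xs = n" "i < n" "j < n" "i \<noteq> j" "xs ! i = xs ! j"
  shows "nbracket xs \<in> leib_n_kernel"
  unfolding leib_n_kernel_def by (rule hull_inc) (use assms in blast)

context leibniz_algebra begin

lemma U_bracket_Cons: "xs \<noteq> [] \<Longrightarrow> U_bracket bracket (x # xs) = \<lbrakk>x, U_bracket bracket xs\<rbrakk>"
  by (cases xs) simp_all

text \<open>An induction principle for perfect algebras: membership in a subspace has to be checked on brackets
  only.\<close>

lemma in_subspace_if_perfect:
  assumes "bracket_sets UNIV UNIV = UNIV" "subspace S" "\<And>x y. \<lbrakk>x, y\<rbrakk> \<in> S"
  shows "u \<in> S"
proof -
  have "bracket_sets UNIV UNIV \<subseteq> S" by (rule bracket_sets_minimal[OF assms(2,3)])
  then show ?thesis unfolding assms(1) by blast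
qed

lemma subspace_bracket_preimage: "subspace S \<Longrightarrow> subspace {u. \<lbrakk>x, u\<rbrakk> \<in> S}" "subspace S \<Longrightarrow> subspace {u. \<lbrakk>u, x\<rbrakk> \<in> S}"
  by (auto simp: subspace_def bracket_simps)

lemma span_U_bracket:
  assumes perfect: "bracket_sets UNIV UNIV = UNIV" and "m > 0"
  shows "span {U_bracket bracket xs | xs. length xs = m} = UNIV"
  using \<open>m > 0\<close>
proof (induction m rule: nat_induct_non_zero)
  case 1
  have "u \<in> span {U_bracket bracket xs | xs. length xs = 1}" for u
    by (rule span_base, rule CollectI, rule exI[of _ "[u]"]) simp
  then show ?case by blast
next
  case (Suc m)
  let ?S = "span {U_bracket bracket xs | xs. length xs = Suc m}"
  have br: "\<lbrakk>x, u\<rbrakk> \<in> ?S" for x u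
  proof -
    have "{U_bracket bracket xs | xs. length xs = m} \<subseteq> {u. \<lbrakk>x, u\<rbrakk> \<in> ?S}"
    proof clarify
      fix xs :: "'v list" assume "m = length xs"
      then have "xs \<noteq> []" using Suc.hyps by auto
      then have "\<lbrakk>x, U_bracket bracket xs\<rbrakk> = U_bracket bracket (x # xs)" by (simp add: U_bracket_Cons)
      then show "\<lbrakk>x, U_bracket bracket xs\<rbrakk> \<in> span {U_bracket bracket ys | ys. length ys = Suc (length xs)}"
        by (intro span_base CollectI exI[of _ "x # xs"]) simp
    qed
    then have "span {U_bracket bracket xs | xs. length xs = m} \<subseteq> {u. \<lbrakk>x, u\<rbrakk> \<in> ?S}"
      by (rule span_minimal) (rule subspace_bracket_preimage(1), simp)
    then show ?thesis unfolding Suc.IH by blast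
  qed
  have "u \<in> ?S" for u by (rule in_subspace_if_perfect[OF perfect subspace_span br])
  then show ?case by blast
qed

text \<open>The factor \<open>3\<close> arises because the Jacobi identity expresses \<open>[x,[y,z]]\<close> through two further double
  brackets, each of which equals \<open>- [x,[y,z]]\<close> modulo \<open>K\<close>, as double brackets alternate modulo \<open>K\<close>.\<close>

theorem perfect_absorbing_subspace_eq_UNIV:
  assumes perfect: "bracket_sets UNIV UNIV = UNIV"
    and three: "(3::'k) \<noteq> 0"
    and K: "subspace K" "\<And>k w. k \<in> K \<Longrightarrow> \<lbrakk>k, w\<rbrakk> \<in> K" "\<And>x u. \<lbrakk>x, \<lbrakk>x, u\<rbrakk>\<rbrakk> \<in> K"
  shows "K = UNIV"
proof -
  note add = subspace_add[OF K(1)] and diff = subspace_diff[OF K(1)]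
  have swap12: "\<lbrakk>x, \<lbrakk>y, z\<rbrakk>\<rbrakk> + \<lbrakk>y, \<lbrakk>x, z\<rbrakk>\<rbrakk> \<in> K" for x y z
  proof -
    have "\<lbrakk>x, \<lbrakk>y, z\<rbrakk>\<rbrakk> + \<lbrakk>y, \<lbrakk>x, z\<rbrakk>\<rbrakk> = \<lbrakk>x + y, \<lbrakk>x + y, z\<rbrakk>\<rbrakk> - \<lbrakk>x, \<lbrakk>x, z\<rbrakk>\<rbrakk> - \<lbrakk>y, \<lbrakk>y, z\<rbrakk>\<rbrakk>"
      by (simp add: bracket_simps)
    then show ?thesis by (simp only: diff K(3))
  qed
  have swap23: "\<lbrakk>x, \<lbrakk>z, y\<rbrakk>\<rbrakk> = - \<lbrakk>x, \<lbrakk>y, z\<rbrakk>\<rbrakk>" for x y z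
    using bracket_leib_kernel_right[OF symmetrized_bracket_in_leib_kernel, of x z y]
    by (simp add: bracket_simps eq_neg_iff_add_eq_0)
  have kernel_bracket: "\<lbrakk>i, w\<rbrakk> \<in> K" if i: "i \<in> leib_kernel" for i w
  proof -
    have "\<lbrakk>i, \<lbrakk>y, z\<rbrakk>\<rbrakk> \<in> K" for y z
      using swap12[of i y z] bracket_leib_kernel_right[OF bracket_leib_kernel[OF i]] by simp
    then have "w \<in> {u. \<lbrakk>i, u\<rbrakk> \<in> K}"
      by (rule in_subspace_if_perfect[OF perfect subspace_bracket_preimage(1)[OF K(1)] CollectI])
    then show ?thesis by simp
  qed
  have triple: "\<lbrakk>\<lbrakk>x, \<lbrakk>y, z\<rbrakk>\<rbrakk>, w\<rbrakk> \<in> K" for x y z w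
  proof -
    let ?T = "\<lbrakk>x, \<lbrakk>y, z\<rbrakk>\<rbrakk>"
    \<comment> \<open>\<open>i\<close> and \<open>j\<close> measure the failure of antisymmetry and lie in the Leibniz kernel; \<open>k\<close> and \<open>l\<close> collect
      the permutations of the arguments of the double bracket and lie in \<open>K\<close>.\<close>
    define i where "i = \<lbrakk>\<lbrakk>x, y\<rbrakk>, z\<rbrakk> + \<lbrakk>z, \<lbrakk>x, y\<rbrakk>\<rbrakk>"
    define j where "j = \<lbrakk>\<lbrakk>x, z\<rbrakk>, y\<rbrakk> + \<lbrakk>y, \<lbrakk>x, z\<rbrakk>\<rbrakk>"
    have ij: "i - j \<in> leib_kernel"
      unfolding i_def j_def by (rule subspace_diff[OF subspace_leib_kernel]) (rule symmetrized_bracket_in_leib_kernel)+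
    have jacobi: "?T = (i - j) - \<lbrakk>z, \<lbrakk>x, y\<rbrakk>\<rbrakk> + \<lbrakk>y, \<lbrakk>x, z\<rbrakk>\<rbrakk>"
      unfolding i_def j_def leibniz_identity[of x y z] by simp
    define k where "k = ?T + \<lbrakk>y, \<lbrakk>x, z\<rbrakk>\<rbrakk>"
    define l where "l = \<lbrakk>x, \<lbrakk>z, y\<rbrakk>\<rbrakk> + \<lbrakk>z, \<lbrakk>x, y\<rbrakk>\<rbrakk>"
    have "(i - j) + (k - l) = (i - j - \<lbrakk>z, \<lbrakk>x, y\<rbrakk>\<rbrakk> + \<lbrakk>y, \<lbrakk>x, z\<rbrakk>\<rbrakk>) + ?T - \<lbrakk>x, \<lbrakk>z, y\<rbrakk>\<rbrakk>"
      unfolding k_def l_def by simp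
    then have "?T + ?T + ?T = (i - j) + (k - l)"
      unfolding jacobi[symmetric] swap23[of x y z] by simp
    moreover have "k - l \<in> K" unfolding k_def l_def by (intro diff swap12)
    moreover have "\<lbrakk>i - j, w\<rbrakk> \<in> K" by (rule kernel_bracket[OF ij])
    ultimately have "\<lbrakk>?T + ?T + ?T, w\<rbrakk> \<in> K" by (simp only: bracket_simps(1)[of "i - j"] K(2) add)
    moreover have "\<lbrakk>?T + ?T + ?T, w\<rbrakk> = 3 *s \<lbrakk>?T, w\<rbrakk>"
    proof -
      have "(3::'k) = 1 + 1 + 1" by simp
      then show ?thesis by (simp only: bracket_simps scale_left_distrib scale_one)
    qed
    ultimately have "3 *s \<lbrakk>?T, w\<rbrakk> \<in> K" by (simp only:)
    then have "inverse 3 *s (3 *s \<lbrakk>?T, w\<rbrakk>) \<in> K" by (rule subspace_scale[OF K(1)])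
    then show ?thesis using three by simp
  qed
  have all: "\<lbrakk>u, w\<rbrakk> \<in> K" for u w
  proof -
    note preimage = subspace_bracket_preimage(2)[OF K(1), of w]
    have "v \<in> {v. \<lbrakk>x, v\<rbrakk> \<in> {u. \<lbrakk>u, w\<rbrakk> \<in> K}}" for x v
      by (rule in_subspace_if_perfect[OF perfect subspace_bracket_preimage(1)[OF preimage]]) (simp add: triple)
    then have "\<lbrakk>x, v\<rbrakk> \<in> {u. \<lbrakk>u, w\<rbrakk> \<in> K}" for x v by simp
    then have "u \<in> {u. \<lbrakk>u, w\<rbrakk> \<in> K}"
      by (rule in_subspace_if_perfect[OF perfect preimage])
    then show ?thesis by simp
  qed
  have "u \<in> K" for u by (rule in_subspace_if_perfect[OF perfect K(1) all])
  then show ?thesis by blast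
qed

text \<open>The arity enters only through the innermost entries: in \<open>[k,[\<dots>]]\<close> and \<open>[x,[x,[\<dots>]]]\<close> the inner
  bracket has length \<open>n - 1 \<ge> 2\<close> and \<open>n - 2 \<ge> 1\<close>, and brackets of a fixed positive length span a
  perfect algebra.\<close>

theorem leib_n_kernel_U_bracket_of_perfect:
  assumes perfect: "bracket_sets UNIV UNIV = UNIV" and three: "(3::'k) \<noteq> 0" and n: "n \<ge> 3"
  shows "leibniz_n_algebra.leib_n_kernel (*s) n (U_bracket bracket) = UNIV"
proof -
  interpret U: leibniz_n_algebra "(*s)" n "U_bracket bracket"
    by (rule leibniz_n_algebra_U) (use n in simp)
  let ?K = U.leib_n_kernel
  note K_ideal = U.n_ideal_leib_n_kernel[unfolded U.n_ideal_def]
  have K: "subspace ?K" using K_ideal by blast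
  have K_first: "U_bracket bracket xs \<in> ?K" if "length xs = n" "xs ! 0 \<in> ?K" for xs
    using K_ideal[THEN conjunct2, rule_format, of 0 xs] that n by simp
  show ?thesis
  proof (rule perfect_absorbing_subspace_eq_UNIV[OF perfect three K])
    fix k w assume k: "k \<in> ?K"
    have "{U_bracket bracket xs | xs. length xs = n - 1} \<subseteq> {w. \<lbrakk>k, w\<rbrakk> \<in> ?K}"
    proof clarify
      fix xs :: "'v list" assume len: "length xs = n - 1"
      then have "xs \<noteq> []" using n by auto
      then show "\<lbrakk>k, U_bracket bracket xs\<rbrakk> \<in> ?K"
        using K_first[of "k # xs"] len k n by (simp add: U_bracket_Cons)
    qed
    then have "span {U_bracket bracket xs | xs. length xs = n - 1} \<subseteq> {w. \<lbrakk>k, w\<rbrakk> \<in> ?K}"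
      by (rule span_minimal) (rule subspace_bracket_preimage(1)[OF K])
    then show "\<lbrakk>k, w\<rbrakk> \<in> ?K" using span_U_bracket[OF perfect, of "n - 1"] n by auto
  next
    fix x u
    have "{U_bracket bracket xs | xs. length xs = n - 2} \<subseteq> {u. \<lbrakk>x, u\<rbrakk> \<in> {v. \<lbrakk>x, v\<rbrakk> \<in> ?K}}"
    proof clarify
      fix xs :: "'v list" assume len: "length xs = n - 2"
      then have "xs \<noteq> []" using n by auto
      then show "\<lbrakk>x, \<lbrakk>x, U_bracket bracket xs\<rbrakk>\<rbrakk> \<in> ?K"
        using U.repeated_entry_in_leib_n_kernel[of "x # x # xs" 0 1] len n by (simp add: U_bracket_Cons)
    qed
    then have "span {U_bracket bracket xs | xs. length xs = n - 2} \<subseteq> {u. \<lbrakk>x, u\<rbrakk> \<in> {v. \<lbrakk>x, v\<rbrakk> \<in> ?K}}"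
      by (rule span_minimal) (intro subspace_bracket_preimage(1) K)
    then show "\<lbrakk>x, \<lbrakk>x, u\<rbrakk>\<rbrakk> \<in> ?K" using span_U_bracket[OF perfect, of "n - 2"] n by auto
  qed
qed

end

theorem theorem2p6:
  fixes scale :: "'k::field_char_0 \<Rightarrow> 'v::ab_group_add \<Rightarrow> 'v"
    and bracket :: "'v \<Rightarrow> 'v \<Rightarrow> 'v"
    and n :: nat
  assumes "leibniz_algebra scale bracket"
    and "\<exists>B. finite B \<and> module.span scale B = UNIV"
    and "leibniz_algebra.semisimple scale bracket"
    and "n \<ge> 3"
  shows "leibniz_n_algebra.leib_n_kernel scale n (U_bracket bracket) = UNIV"
proof -
  interpret L: leibniz_algebra scale bracket by fact
  obtain B where B: "finite B" "L.span B = UNIV" using assms(2) by blast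
  obtain B' where B': "B' \<subseteq> B" "L.independent B'" "B \<subseteq> L.span B'"
    using L.maximal_independent_subset[of B] by blast
  have "L.span B \<subseteq> L.span B'" using B'(3) by (intro L.span_minimal) simp_all
  interpret L: finite_dim_leibniz_algebra scale bracket B'
  proof unfold_locales
    show "finite B'" using B' B(1) finite_subset by blast
    show "L.span B' = UNIV" using \<open>L.span B \<subseteq> L.span B'\<close> B(2) by blast
  qed (use B' in \<open>simp_all add: L.bracket_simps\<close>)
  show ?thesis
    by (rule L.leib_n_kernel_U_bracket_of_perfect[OF L.semisimple_perfect[OF assms(3)] _ assms(4)]) simp
qed

end
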